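(* Let $H$ be an antiferromagnetic model on a finite nonempty set $I$. For every finite simple graph $G$, $$\hom(G,H)\ \ge\ \prod_{v\in V(G)} \hom(K_{d_v+1},H)^{1/(d_v+1)},$$ where $d_v=\deg_G(v)$ for each $v\in V(G)$.
   Context: Let $I$ be a finite nonempty set (of spins). A model on $I$ is a symmetric real matrix $H=(H(\sigma,\tau):\sigma,\tau\in I)$ with nonnegative entries (equivalently, an edge-weighted graph on $I$, possibly with loops). A symmetric entrywise-nonnegative matrix is antiferromagnetic if it has at most one positive eigenvalue, counted with multiplicity; a model is antiferromagnetic if its matrix is. For a finite simple graph $G$, $\hom(G,H)=\sum_{\phi\colon V(G)\to I}\ \prod_{uv\in E(G)}H(\phi(u),\phi(v))$. $K_m$ denotes the complete graph on $m$ vertices. *)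

theory Defs
  imports "HOL-Analysis.Analysis" "HOL-Computational_Algebra.Polynomial" "HOL-Library.Ramsey"
begin

(* The finite nonempty set of spins is the index type 'i. *)
definition model :: "real ^ 'i ^ 'i \<Rightarrow> bool" where
  "model H \<longleftrightarrow> transpose H = H \<and> (\<forall>\<sigma> \<tau>. 0 \<le> H $ \<sigma> $ \<tau>)"

definition charpoly :: "real ^ 'i ^ 'i \<Rightarrow> real poly" where
  "charpoly A = det (mat [:0, 1:] - map_matrix (\<lambda>c. [:c:]) A)"

(* The multiset of real roots of the characteristic polynomial. For a symmetric matrix all
   eigenvalues are real, so this is the full spectrum. *)
definition eigenvalues :: "real ^ 'i ^ 'i \<Rightarrow> real multiset" where
  "eigenvalues A = proots (charpoly A)"

definition antiferromagnetic :: "real ^ 'i ^ 'i \<Rightarrow> bool" where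
  "antiferromagnetic H \<longleftrightarrow> model H \<and> size {# x \<in># eigenvalues H. 0 < x #} \<le> 1"

(* Edges are 2-element subsets of the vertex set, which may be empty. *)
definition finite_simple_graph :: "'v set \<Rightarrow> 'v set set \<Rightarrow> bool" where
  "finite_simple_graph V E \<longleftrightarrow> finite V \<and> E \<subseteq> nsets V 2"

definition degree_in :: "'v set set \<Rightarrow> 'v \<Rightarrow> nat" where
  "degree_in E v = card {e \<in> E. v \<in> e}"

(* H(\<phi>(u), \<phi>(v)) for the unordered edge e = {u, v}; independent of the order of the
   endpoints because H is symmetric, see edge_weight_doubleton. *)
definition edge_weight :: "real ^ 'i ^ 'i \<Rightarrow> ('v \<Rightarrow> 'i) \<Rightarrow> 'v set \<Rightarrow> real" where
  "edge_weight H \<phi> e = (THE w. \<exists>u v. e = {u, v} \<and> w = H $ \<phi> u $ \<phi> v)"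

lemma edge_weight_doubleton:
  assumes "model H"
  shows "edge_weight H \<phi> {u, v} = H $ \<phi> u $ \<phi> v"
proof -
  have sym: "H $ a $ b = H $ b $ a" for a b
    using assms unfolding model_def by (metis transpose_def vec_lambda_beta)
  show ?thesis
    unfolding edge_weight_def
    by (rule the_equality) (auto simp: doubleton_eq_iff sym)
qed

(* Maps from V to the spins are represented by the extensional functions on V. *)
definition hom :: "'v set \<Rightarrow> 'v set set \<Rightarrow> real ^ 'i ^ 'i \<Rightarrow> real" where
  "hom V E H = (\<Sum>\<phi> \<in> V \<rightarrow>\<^sub>E UNIV. \<Prod>e\<in>E. edge_weight H \<phi> e)"

definition hom_complete :: "nat \<Rightarrow> real ^ 'i ^ 'i \<Rightarrow> real" where
  "hom_complete m H = hom {..<m} (nsets {..<m} 2) H"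

end

theory Submission
  imports Defs
begin

text \<open>For strictly positive \<open>H\<close> the inequality holds with an arbitrary positive external field at each
  vertex, the clique of \<open>v\<close> carrying the field of \<open>v\<close> everywhere; in this form it is proved by
  deleting a vertex \<open>v\<close> of maximum degree \<open>d\<close>. Jensen's inequality for the sum over the spin of \<open>v\<close>,
  applied with the one-vertex marginal of the Gibbs measure on \<open>K\<^sub>n\<close>, \<open>n = d + 1\<close>, with the field of \<open>v\<close>,
  separates the neighbours, and leaves a comparison of that Gibbs measure with one on \<open>K\<^sub>m\<close>, \<open>m \<le> n\<close>,
  for each neighbour. The comparison is an induction on \<open>m\<close> based on the fact that pinning a spin
  increases the mutual information of two other spins. The latter is a form of the reverse
  Cauchy-Schwarz inequality for the pair marginals of cliques, which descends from \<open>H\<close> itself by a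
  trickle-down argument. A general \<open>H\<close> is a limit of positive antiferromagnetic models.\<close>

section \<open>Spectral theorem and reverse Cauchy-Schwarz inequality\<close>

text \<open>For small \<open>t\<close> of the sign of \<open>a\<close> the linear term dominates the
  quadratic one. This serves as the first-order condition at a maximum.\<close>

lemma linear_term_zero:
  fixes a b :: real
  assumes "\<And>t. a * t + b * t\<^sup>2 \<le> 0"
  shows "a = 0"
proof (rule ccontr)
  assume a: "a \<noteq> 0"
  define \<epsilon> where "\<epsilon> = 1 / (1 + \<bar>b\<bar>)"
  have \<epsilon>: "\<epsilon> > 0" by (simp add: \<epsilon>_def add_pos_nonneg)
  have "- (b * \<epsilon>) \<le> \<bar>b\<bar> * \<epsilon>"
    using \<epsilon> by (metis abs_ge_minus_self less_eq_real_def mult_minus_left mult_right_mono)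
  also have "\<dots> < 1" by (simp add: \<epsilon>_def field_simps)
  finally have pos: "1 + b * \<epsilon> > 0" by simp
  have "a * (\<epsilon> * a) + b * (\<epsilon> * a)\<^sup>2 = a\<^sup>2 * \<epsilon> * (1 + b * \<epsilon>)"
    by (simp add: power2_eq_square algebra_simps)
  with assms[of "\<epsilon> * a"] have "a\<^sup>2 * \<epsilon> * (1 + b * \<epsilon>) \<le> 0" by simp
  moreover have "a\<^sup>2 * \<epsilon> * (1 + b * \<epsilon>) > 0" using a \<epsilon> pos by simp
  ultimately show False by simp
qed

lemma symmetric_matrix_inner:
  fixes A :: "real ^ 'n ^ 'n"
  assumes "transpose A = A"
  shows "x \<bullet> (A *v y) = y \<bullet> (A *v x)"
  by (metis assms dot_lmul_matrix inner_commute transpose_matrix_vector)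

text \<open>The Rayleigh quotient attains its maximum on the unit sphere of \<open>S\<close> by
  compactness. Invariance puts the residual \<open>A *v x - \<kappa> *\<^sub>R x\<close> into
  \<open>S\<close>, so \<open>x\<close> may be varied in that direction, and maximality forces the
  residual to vanish.\<close>

lemma symmetric_max_eigenvector:
  fixes A :: "real ^ 'n ^ 'n"
  assumes sym: "transpose A = A" and S: "subspace S" "S \<noteq> {0}"
    and inv: "\<And>x. x \<in> S \<Longrightarrow> A *v x \<in> S"
  obtains x \<kappa> where "x \<in> S" "norm x = 1" "A *v x = \<kappa> *\<^sub>R x"
    "\<And>y. y \<in> S \<Longrightarrow> y \<bullet> (A *v y) \<le> \<kappa> * (y \<bullet> y)"
proof -
  let ?K = "S \<inter> sphere 0 1"
  have cpt: "compact ?K"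
    using closed_subspace[OF S(1)] by (metis compact_sphere closed_Int_compact)
  obtain z where z: "z \<in> S" "z \<noteq> 0" using S subspace_0 by blast
  have "z /\<^sub>R norm z \<in> ?K" using z S(1) by (simp add: subspace_scale)
  then have ne: "?K \<noteq> {}" by blast
  have "continuous_on ?K (\<lambda>x. x \<bullet> (A *v x))"
    by (intro continuous_intros)
  from continuous_attains_sup[OF cpt ne this] obtain x where x: "x \<in> ?K"
    and max: "\<And>y. y \<in> ?K \<Longrightarrow> y \<bullet> (A *v y) \<le> x \<bullet> (A *v x)" by blast
  define \<kappa> where "\<kappa> = x \<bullet> (A *v x)"
  have le: "y \<bullet> (A *v y) \<le> \<kappa> * (y \<bullet> y)" if "y \<in> S" for y
  proof (cases "y = 0")
    case False
    have "y /\<^sub>R norm y \<in> ?K" using that False S(1) by (simp add: subspace_scale)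
    from max[OF this] have "inverse (norm y) * (inverse (norm y) * (y \<bullet> (A *v y))) \<le> \<kappa>"
      by (simp add: \<kappa>_def matrix_vector_mult_scaleR)
    then have "(y \<bullet> (A *v y)) / (norm y)\<^sup>2 \<le> \<kappa>"
      by (simp add: power2_eq_square field_simps)
    then show ?thesis using False by (simp add: divide_le_eq power2_norm_eq_inner)
  qed simp
  have xx: "x \<bullet> x = 1" using x by (simp add: dot_square_norm)
  define g where "g = A *v x - \<kappa> *\<^sub>R x"
  have gS: "g \<in> S" using x inv S(1) by (simp add: g_def subspace_diff subspace_scale)
  have "(2 * (g \<bullet> g)) * t + (g \<bullet> (A *v g) - \<kappa> * (g \<bullet> g)) * t\<^sup>2 \<le> 0" for t
  proof -
    have "x + t *\<^sub>R g \<in> S" using x gS S(1) by (simp add: subspace_add subspace_scale)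
    from le[OF this]
    have "\<kappa> + t * (x \<bullet> (A *v g)) + t * (g \<bullet> (A *v x)) + t\<^sup>2 * (g \<bullet> (A *v g))
        \<le> \<kappa> + 2 * t * \<kappa> * (x \<bullet> g) + t\<^sup>2 * \<kappa> * (g \<bullet> g)"
      by (simp add: \<kappa>_def[symmetric] xx matrix_vector_right_distrib matrix_vector_mult_scaleR
          inner_add_left inner_add_right inner_commute[of g x] power2_eq_square algebra_simps)
    moreover have "g \<bullet> (A *v x) = g \<bullet> g + \<kappa> * (x \<bullet> g)"
      by (simp add: g_def inner_diff_right inner_commute algebra_simps)
    moreover have "x \<bullet> (A *v g) = g \<bullet> (A *v x)" by (rule symmetric_matrix_inner[OF sym])
    ultimately show ?thesis by (simp add: algebra_simps)
  qed
  then have "g = 0" using linear_term_zero by fastforce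
  then show thesis using that[of x \<kappa>] x le by (simp add: g_def)
qed

text \<open>Induction on the set of indices: the orthogonal complement of the eigenvectors found so
  far is invariant by symmetry and nonzero by dimension, so it contains a further unit
  eigenvector.\<close>

lemma orthonormal_eigenbasis:
  fixes A :: "real ^ 'n ^ 'n"
  assumes sym: "transpose A = A"
  obtains e :: "'n \<Rightarrow> real ^ 'n" and d where
    "\<And>i j. e i \<bullet> e j = (if i = j then 1 else 0)" "\<And>i. A *v e i = d i *\<^sub>R e i"
proof -
  have "\<exists>e d. (\<forall>i\<in>I. \<forall>j\<in>I. (e i :: real ^ 'n) \<bullet> e j = (if i = j then 1 else 0)) \<and>
      (\<forall>i\<in>I. A *v e i = d i *\<^sub>R e i)" for I :: "'n set"
  proof (induction I rule: finite_induct[OF finite])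
    case (2 k I)
    then obtain e d where e: "\<And>i j. i \<in> I \<Longrightarrow> j \<in> I \<Longrightarrow> (e i :: real ^ 'n) \<bullet> e j = (if i = j then 1 else 0)"
      and d: "\<And>i. i \<in> I \<Longrightarrow> A *v e i = d i *\<^sub>R e i" by blast
    define S where "S = {x. \<forall>j\<in>I. e j \<bullet> x = 0}"
    have sub: "subspace S" by (auto simp: S_def subspace_def inner_add_right)
    have "dim (e ` I) \<le> card (e ` I)" by (simp add: dim_le_card')
    also have "\<dots> \<le> card I" by (simp add: card_image_le)
    also have "\<dots> < CARD('n)" using 2 by (metis finite psubset_card_mono UNIV_I psubsetI subset_UNIV)
    finally have "dim (e ` I) < DIM(real ^ 'n)" by simp
    from orthogonal_to_subspace_exists[OF this] obtain z where "z \<noteq> 0" and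
      z: "\<And>y. y \<in> span (e ` I) \<Longrightarrow> orthogonal z y" by blast
    have "e j \<bullet> z = 0" if "j \<in> I" for j
      using z[OF span_base[OF imageI[OF that]]] by (simp add: orthogonal_def inner_commute)
    then have "z \<in> S" by (simp add: S_def)
    with \<open>z \<noteq> 0\<close> have ne: "S \<noteq> {0}" by blast
    have inv: "A *v x \<in> S" if "x \<in> S" for x
      using that d symmetric_matrix_inner[OF sym, of _ x] by (auto simp: S_def inner_commute)
    obtain x \<kappa> where x: "x \<in> S" "norm x = 1" "A *v x = \<kappa> *\<^sub>R x"
      using symmetric_max_eigenvector[OF sym sub ne inv] by metis
    have "\<forall>i\<in>insert k I. \<forall>j\<in>insert k I. (e(k := x)) i \<bullet> (e(k := x)) j = (if i = j then 1 else 0)"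
      using x e 2(2) by (auto simp: S_def inner_commute dot_square_norm[of x])
    moreover have "\<forall>i\<in>insert k I. A *v (e(k := x)) i = (d(k := \<kappa>)) i *\<^sub>R (e(k := x)) i"
      using x d 2 by auto
    ultimately show ?case by blast
  qed simp
  from this[of UNIV] show thesis using that by auto
qed

section \<open>Characteristic polynomial and spectrum of a symmetric matrix\<close>

lemma map_matrix_const_mult:
  fixes A B :: "real ^ 'n ^ 'n"
  shows "map_matrix (\<lambda>c. [:c:]) (A ** B) = map_matrix (\<lambda>c. [:c:]) A ** map_matrix (\<lambda>c. [:c:]) B"
proof -
  have "[:sum f S:] = (\<Sum>x\<in>S. [:f x:])" for f :: "'n \<Rightarrow> real" and S
  proof (induction S rule: infinite_finite_induct)
    case (insert x S)
    then show ?case by (simp flip: insert.IH)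
  qed simp_all
  then show ?thesis by (simp add: vec_eq_iff matrix_matrix_mult_def mult.commute)
qed

text \<open>The orthogonal matrix \<open>P\<close> with rows \<open>e i\<close> conjugates
  \<open>A\<close> to the diagonal matrix \<open>D\<close>. Read as a matrix of constant
  polynomials, it conjugates the matrix inside \<open>charpoly A\<close> to a diagonal one with the
  same determinant.\<close>

lemma charpoly_eigenbasis:
  fixes A :: "real ^ 'n ^ 'n" and e :: "'n \<Rightarrow> real ^ 'n"
  assumes e: "\<And>i j. e i \<bullet> e j = (if i = j then 1 else 0)" and d: "\<And>i. A *v e i = d i *\<^sub>R e i"
  shows "charpoly A = (\<Prod>i\<in>UNIV. [:- d i, 1:])"
proof -
  let ?m = "map_matrix (\<lambda>c. [:c:]) :: real ^ 'n ^ 'n \<Rightarrow> real poly ^ 'n ^ 'n"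
  let ?X = "mat [:0, 1:] :: real poly ^ 'n ^ 'n"
  define P where "P = (\<chi> i. e i)"
  define D where "D = (\<chi> i j. if i = j then d i else 0)"
  have "(P ** transpose P) $ i $ j = e i \<bullet> e j" for i j
    by (simp add: P_def matrix_matrix_mult_def transpose_def inner_vec_def)
  then have PP: "P ** transpose P = mat 1"
    by (simp add: vec_eq_iff mat_def e)
  have "(P ** (A ** transpose P)) $ i $ j = D $ i $ j" for i j
  proof -
    have "(A ** transpose P) $ k $ j = d j * e j $ k" for k
      using arg_cong[OF d[of j], of "\<lambda>v. v $ k"]
      by (simp add: P_def matrix_matrix_mult_def matrix_vector_mult_def transpose_def)
    then have "(P ** (A ** transpose P)) $ i $ j = d j * (e i \<bullet> e j)"
      unfolding matrix_matrix_mult_def[of P]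
      by (simp add: P_def inner_vec_def sum_distrib_left mult_ac)
    then show ?thesis by (simp add: e D_def)
  qed
  then have PAP: "P ** (A ** transpose P) = D" by (simp add: vec_eq_iff)
  have m1: "?m (mat 1) = mat 1" by (simp add: vec_eq_iff mat_def one_pCons)
  have "?m P ** ((?X - ?m A) ** ?m (transpose P)) = ?X - ?m D"
  proof -
    have X: "?m P ** ?X = ?X ** ?m P"
      by (simp add: vec_eq_iff matrix_matrix_mult_def mat_def if_distrib if_distribR sum.If_cases
          sum.delta sum.delta' mult.commute cong: if_cong)
    have diff: "(B - C) ** M = B ** M - C ** M" "M ** (B - C) = M ** B - M ** C"
      for B C M :: "real poly ^ 'n ^ 'n"
      by (simp_all add: vec_eq_iff matrix_matrix_mult_def left_diff_distrib right_diff_distrib sum_subtractf)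
    have "?m P ** ((?X - ?m A) ** ?m (transpose P))
        = ?m P ** (?X ** ?m (transpose P)) - ?m P ** (?m A ** ?m (transpose P))"
      by (simp only: diff)
    also have "?m P ** (?X ** ?m (transpose P)) = ?X ** (?m P ** ?m (transpose P))"
      by (simp only: matrix_mul_assoc X)
    also have "?m P ** ?m (transpose P) = mat 1"
      by (simp only: map_matrix_const_mult[symmetric] PP m1)
    also have "?m P ** (?m A ** ?m (transpose P)) = ?m D"
      by (simp only: map_matrix_const_mult[symmetric] PAP)
    finally show ?thesis by (simp only: matrix_mul_rid)
  qed
  from arg_cong[OF this, of det] have "det (?m P) * (charpoly A * det (?m (transpose P))) = det (?X - ?m D)"
    by (simp only: det_mul charpoly_def)
  moreover have "det (?m P) * det (?m (transpose P)) = 1"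
    by (simp only: det_mul[symmetric] map_matrix_const_mult[symmetric] PP m1 det_I)
  moreover have "c = y" if "a * (c * b) = y" "a * b = 1" for a b c y :: "real poly"
    using that by (metis mult.left_commute mult.right_neutral)
  ultimately have "charpoly A = det (?X - ?m D)" by blast
  also have "\<dots> = (\<Prod>i\<in>UNIV. (?X - ?m D) $ i $ i)"
    by (rule det_diagonal) (simp add: mat_def D_def)
  finally show ?thesis by (simp add: mat_def D_def)
qed

text \<open>Each linear factor contributes one root. This ties the multiset counted in
  \<open>antiferromagnetic\<close> to the family \<open>d\<close>, multiplicities included.\<close>

lemma eigenvalues_eigenbasis:
  fixes A :: "real ^ 'n ^ 'n" and e :: "'n \<Rightarrow> real ^ 'n"
  assumes "\<And>i j. e i \<bullet> e j = (if i = j then 1 else 0)" and "\<And>i. A *v e i = d i *\<^sub>R e i"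
  shows "eigenvalues A = image_mset d (mset_set UNIV)"
proof -
  have "proots (\<Prod>i\<in>I. [:- d i, 1:]) = image_mset d (mset_set I)" for I :: "'n set"
  proof (induction I rule: finite_induct[OF finite])
    case (2 k I)
    then show ?case by (simp add: proots_mult del: mult_pCons_left)
  qed simp
  then show ?thesis using charpoly_eigenbasis[OF assms] by (simp add: eigenvalues_def)
qed

text \<open>At most one basis vector \<open>e k\<close> carries a positive eigenvalue, so the form
  is nonpositive on the orthogonal complement of \<open>e k\<close>. Subtracting a multiple of
  \<open>f\<close> brings \<open>g\<close> there, and completing the square gives the claim.\<close>

lemma antiferromagnetic_reverse_Cauchy_Schwarz:
  fixes H :: "real ^ 'n ^ 'n"
  assumes af: "antiferromagnetic H" and f: "\<And>i. 0 \<le> f $ i"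
  shows "(f \<bullet> (H *v f)) * (g \<bullet> (H *v g)) \<le> (f \<bullet> (H *v g))\<^sup>2"
proof -
  have sym: "transpose H = H" and nn: "\<And>i j. 0 \<le> H $ i $ j"
    using af by (auto simp: antiferromagnetic_def model_def)
  obtain e :: "'n \<Rightarrow> real ^ 'n" and d where
    e: "\<And>i j. e i \<bullet> e j = (if i = j then 1 else 0)" and d: "\<And>i. H *v e i = d i *\<^sub>R e i"
    using orthonormal_eigenbasis[OF sym] by metis
  have card: "card {i. 0 < d i} \<le> 1"
    using af by (simp add: antiferromagnetic_def eigenvalues_eigenbasis[OF e d] filter_mset_image_mset)
  have indep: "independent (range e)" and inj: "inj e"
  proof -
    show "inj e" by (rule injI) (metis e zero_neq_one)
    have "pairwise orthogonal (range e)" by (auto simp: pairwise_def orthogonal_def e)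
    moreover have "0 \<notin> range e" using e by (metis imageE inner_zero_left zero_neq_one)
    ultimately show "independent (range e)" by (rule pairwise_orthogonal_independent)
  qed
  have "span (range e) = UNIV"
    using card_ge_dim_independent[of "range e" UNIV] indep by (auto simp: card_image[OF inj] dim_subset_UNIV_cart)
  have expand: "x = (\<Sum>i\<in>UNIV. (e i \<bullet> x) *\<^sub>R e i)" for x
  proof -
    have "x \<in> span (range e)" by (simp add: \<open>span (range e) = UNIV\<close>)
    then obtain c where c: "x = (\<Sum>i\<in>UNIV. c i *\<^sub>R e i)"
      by (auto simp: span_finite sum.reindex[OF inj, simplified] image_iff)
    have "e i \<bullet> x = c i" for i by (simp add: c inner_sum_right e if_distrib cong: if_cong)
    then show ?thesis using c by simp
  qed
  have form: "x \<bullet> (H *v x) = (\<Sum>i\<in>UNIV. d i * (e i \<bullet> x)\<^sup>2)" for x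
  proof -
    have "e i \<bullet> (H *v x) = d i * (e i \<bullet> x)" for i
      by (metis d inner_commute inner_scaleR_left symmetric_matrix_inner[OF sym])
    moreover have "x \<bullet> (H *v x) = (\<Sum>i\<in>UNIV. (e i \<bullet> x) * (e i \<bullet> (H *v x)))"
      by (subst (1) expand[of x]) (simp add: inner_sum_left)
    ultimately show ?thesis by (simp add: power2_eq_square mult_ac)
  qed
  show ?thesis
  proof (cases "0 < f \<bullet> (H *v f)")
    case False
    moreover have "0 \<le> f \<bullet> (H *v f)"
      unfolding inner_vec_def matrix_vector_mult_def using f nn by (auto intro!: sum_nonneg mult_nonneg_nonneg)
    ultimately show ?thesis by simp
  next
    case True
    \<comment> \<open>If no eigenvalue is positive, any index serves as \<open>k\<close>.\<close>
    obtain k where k: "\<And>i. i \<noteq> k \<Longrightarrow> d i \<le> 0"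
    proof -
      show thesis
      proof (cases "{i. 0 < d i} = {}")
        case False
        then obtain k where "0 < d k" by blast
        moreover have "i = j" if "0 < d i" "0 < d j" for i j
          using card that by (auto simp: card_le_Suc0_iff_eq)
        ultimately show thesis using that[of k] by (metis linorder_not_less)
      qed (use that in \<open>auto simp: not_less\<close>)
    qed
    have neg: "x \<bullet> (H *v x) \<le> 0" if "e k \<bullet> x = 0" for x
      unfolding form using that k
      by (intro sum_nonpos) (metis (no_types) mult_nonpos_nonneg order_refl mult_zero_right zero_le_power2 zero_power2)
    have fk: "e k \<bullet> f \<noteq> 0" using neg[of f] True by linarith
    \<comment> \<open>\<open>t\<close> cancels the component of \<open>g - t *\<^sub>R f\<close>
      along \<open>e k\<close>.\<close>
    define t where "t = (e k \<bullet> g) / (e k \<bullet> f)"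
    have "(g - t *\<^sub>R f) \<bullet> (H *v (g - t *\<^sub>R f)) \<le> 0"
      using fk by (intro neg) (simp add: t_def inner_diff_right)
    then have "g \<bullet> (H *v g) - 2 * t * (f \<bullet> (H *v g)) + t\<^sup>2 * (f \<bullet> (H *v f)) \<le> 0"
      using symmetric_matrix_inner[OF sym, of g f]
      by (simp add: matrix_vector_mult_diff_distrib matrix_vector_mult_scaleR inner_diff_left inner_diff_right
          power2_eq_square algebra_simps)
    from mult_left_mono[OF this, of "f \<bullet> (H *v f)"] True
    have "(f \<bullet> (H *v f)) * (g \<bullet> (H *v g)) + (t * (f \<bullet> (H *v f)) - f \<bullet> (H *v g))\<^sup>2 \<le> (f \<bullet> (H *v g))\<^sup>2"
      by (simp add: power2_eq_square algebra_simps)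
    then show ?thesis by (smt (verit) zero_le_power2)
  qed
qed

section \<open>Gibbs measures on cliques\<close>

definition bform :: "('i::finite \<Rightarrow> 'i \<Rightarrow> real) \<Rightarrow> ('i \<Rightarrow> real) \<Rightarrow> ('i \<Rightarrow> real) \<Rightarrow> real" where
  "bform M f g = (\<Sum>s\<in>UNIV. \<Sum>t\<in>UNIV. M s t * f s * g t)"

lemma bform_commute:
  assumes "\<And>s t. M s t = M t s"
  shows "bform M f g = bform M g f"
  unfolding bform_def using assms by (subst sum.swap) (simp add: mult_ac)

lemma bform_add_scale_right: "bform M f (\<lambda>s. g s + c * k s) = bform M f g + c * bform M f k"
  by (simp add: bform_def algebra_simps sum.distrib sum_distrib_left)

lemma bform_one_left:
  assumes "\<And>s t. M s t = M t s"
  shows "bform M (\<lambda>_. 1) g = (\<Sum>s\<in>UNIV. (\<Sum>t\<in>UNIV. M s t) * g s)"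
  unfolding bform_def using assms by (subst sum.swap) (simp add: sum_distrib_right)

text \<open>For symmetric \<open>M\<close> of positive total mass this means that the form is
  nonpositive on every \<open>g\<close> with \<open>bform M (\<lambda>_. 1) g = 0\<close>, so that
  it has only one positive direction.\<close>

definition lorentz :: "('i::finite \<Rightarrow> 'i \<Rightarrow> real) \<Rightarrow> bool" where
  "lorentz M \<longleftrightarrow> (\<forall>g. bform M (\<lambda>_. 1) (\<lambda>_. 1) * bform M g g \<le> (bform M (\<lambda>_. 1) g)\<^sup>2)"

text \<open>The reversible chain with transition matrix \<open>N s t / w s\<close> has, by the second assumption,
  only eigenvalues \<open>\<kappa>\<close> with \<open>\<kappa> \<le> \<kappa>\<^sup>2\<close>. On the orthogonal complement of the constants the maximum
  principle gives \<open>\<kappa> < 1\<close>, hence \<open>\<kappa> \<le> 0\<close>.\<close>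
lemma lorentz_trickle_down:
  fixes N :: "'i::finite \<Rightarrow> 'i \<Rightarrow> real"
  assumes sym: "\<And>s t. N s t = N t s" and pos: "\<And>s t. 0 < N s t"
    and le: "\<And>g. bform N g g \<le> (\<Sum>s\<in>UNIV. (\<Sum>t\<in>UNIV. N s t * g t)\<^sup>2 / (\<Sum>t\<in>UNIV. N s t))"
  shows "lorentz N"
proof -
  define w where "w s = (\<Sum>t\<in>UNIV. N s t)" for s
  have w: "0 < w s" for s unfolding w_def using pos by (intro sum_pos) auto
  have colsum: "(\<Sum>s\<in>UNIV. N s t) = w t" for t by (simp add: w_def sym[of t])
  \<comment> \<open>It is enough to treat functions of \<open>w\<close>-mean zero; the general case
    follows by subtracting a constant.\<close>
  have neg: "bform N k k \<le> 0" if k: "(\<Sum>s\<in>UNIV. w s * k s) = 0" for k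
  proof (rule ccontr)
    assume "\<not> bform N k k \<le> 0"
    then have kpos: "0 < bform N k k" by simp
    \<comment> \<open>\<open>A\<close> is the transition matrix \<open>N s t / w s\<close> made
      symmetric by conjugation with \<open>sqrt (w s)\<close>. It fixes \<open>v\<close>, so
      \<open>S\<close> is invariant, and a positive value of the form on \<open>S\<close> yields an
      eigenvalue \<kappa> > 0 there.\<close>
    define A :: "real ^ 'i ^ 'i" where "A = (\<chi> s t. N s t / (sqrt (w s) * sqrt (w t)))"
    define v :: "real ^ 'i" where "v = (\<chi> s. sqrt (w s))"
    define S where "S = {f. v \<bullet> f = 0}"
    have form: "f \<bullet> (A *v f) = bform N (\<lambda>s. f $ s / sqrt (w s)) (\<lambda>s. f $ s / sqrt (w s))" for f
      by (simp add: A_def bform_def inner_vec_def matrix_vector_mult_def sum_distrib_left mult_ac)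
    have symA: "transpose A = A" by (simp add: vec_eq_iff A_def transpose_def sym mult.commute)
    have subS: "subspace S" by (auto simp: S_def subspace_def inner_add_right)
    define f0 :: "real ^ 'i" where "f0 = (\<chi> s. sqrt (w s) * k s)"
    have sq: "sqrt (w s) * sqrt (w s) = w s" "sqrt (w s) \<noteq> 0" for s using w[of s] by auto
    have "v \<bullet> f0 = (\<Sum>s\<in>UNIV. w s * k s)"
      using w by (simp add: v_def f0_def inner_vec_def less_imp_le flip: mult.assoc)
    then have f0S: "f0 \<in> S" by (simp add: S_def k)
    have f0pos: "f0 \<bullet> (A *v f0) > 0" using kpos by (simp add: form f0_def less_imp_neq[OF w, symmetric])
    then have ne: "S \<noteq> {0}" using f0S by auto
    have "A *v v = v"
    proof -
      have "(\<Sum>t\<in>UNIV. N s t / (sqrt (w s) * sqrt (w t)) * sqrt (w t)) = sqrt (w s)" for s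
      proof -
        have "(\<Sum>t\<in>UNIV. N s t / (sqrt (w s) * sqrt (w t)) * sqrt (w t)) = (\<Sum>t\<in>UNIV. N s t) / sqrt (w s)"
          using sq by (simp add: sum_divide_distrib)
        also have "\<dots> = sqrt (w s)" using w[of s] by (simp add: w_def[symmetric] real_div_sqrt)
        finally show ?thesis .
      qed
      then show ?thesis by (simp add: vec_eq_iff A_def v_def matrix_vector_mult_def)
    qed
    then have inv: "A *v f \<in> S" if "f \<in> S" for f
      using that symmetric_matrix_inner[OF symA, of v f] by (simp add: S_def inner_commute)
    obtain f \<kappa> where f: "f \<in> S" "norm f = 1" "A *v f = \<kappa> *\<^sub>R f"
      and max: "\<And>y. y \<in> S \<Longrightarrow> y \<bullet> (A *v y) \<le> \<kappa> * (y \<bullet> y)"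
      using symmetric_max_eigenvector[OF symA subS ne inv] by metis
    have ff: "f \<bullet> f = 1" using f(2) by (simp add: dot_square_norm)
    have "0 < \<kappa> * (f0 \<bullet> f0)" using max[OF f0S] f0pos by linarith
    then have \<kappa>0: "0 < \<kappa>" by (metis inner_ge_zero mult_nonpos_nonneg not_le)
    define g where "g s = f $ s / sqrt (w s)" for s
    have fg: "f $ s = sqrt (w s) * g s" for s using sq by (simp add: g_def)
    have Ng: "(\<Sum>t\<in>UNIV. N s t * g t) = \<kappa> * w s * g s" for s
    proof -
      have "(\<Sum>t\<in>UNIV. N s t * g t) = sqrt (w s) * (A *v f) $ s"
        using sq by (simp add: A_def matrix_vector_mult_def sum_distrib_left g_def)
      also have "\<dots> = \<kappa> * (sqrt (w s) * sqrt (w s)) * g s" by (simp add: f fg)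
      finally show ?thesis by (simp add: abs_of_pos[OF w])
    qed
    have wg2: "(\<Sum>s\<in>UNIV. w s * (g s)\<^sup>2) = 1"
    proof -
      have "f \<bullet> f = (\<Sum>s\<in>UNIV. (sqrt (w s) * sqrt (w s)) * (g s)\<^sup>2)"
        by (simp add: inner_vec_def fg power2_eq_square mult_ac)
      then show ?thesis using ff by (simp add: abs_of_pos[OF w])
    qed
    have wg: "(\<Sum>s\<in>UNIV. w s * g s) = 0"
    proof -
      have "v \<bullet> f = (\<Sum>s\<in>UNIV. (sqrt (w s) * sqrt (w s)) * g s)"
        by (simp add: inner_vec_def fg v_def mult_ac)
      then show ?thesis using f(1) by (simp add: abs_of_pos[OF w] S_def)
    qed
    have "bform N g g = f \<bullet> (A *v f)" by (simp add: form g_def[abs_def])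
    also have "\<dots> = \<kappa>" by (simp add: f ff)
    \<comment> \<open>For the eigenfunction \<open>g\<close>, scaled so that the sum of
      \<open>w s * (g s)\<^sup>2\<close> is 1, the assumption on \<open>N\<close> reads
      \<open>\<kappa> \<le> \<kappa>\<^sup>2\<close>.\<close>
    finally have "\<kappa> \<le> (\<Sum>s\<in>UNIV. (\<kappa> * w s * g s)\<^sup>2 / w s)"
      using le[of g] by (simp add: Ng w_def[symmetric])
    also have "\<dots> = \<kappa>\<^sup>2 * (\<Sum>s\<in>UNIV. w s * (g s)\<^sup>2)"
      unfolding sum_distrib_left using w by (intro sum.cong) (auto simp: power2_eq_square field_simps)
    finally have "\<kappa> * 1 \<le> \<kappa> * \<kappa>" by (simp only: wg2 power2_eq_square[of \<kappa>] mult_1_right)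
    then have \<kappa>1: "1 \<le> \<kappa>" using \<kappa>0 by (simp only: mult_le_cancel_left_pos)
    obtain a where a: "\<And>b. g b \<le> g a"
    proof -
      have "Max (range g) \<in> range g" by (intro Max_in) auto
      then obtain a where "Max (range g) = g a" by blast
      then show thesis using that[of a] by (metis Max_ge finite finite_imageI rangeI)
    qed
    have ga: "0 \<le> g a"
    proof (rule ccontr)
      assume "\<not> 0 \<le> g a"
      then have neg: "w s * g s < 0" for s using a[of s] w[of s] by (simp add: mult_pos_neg)
      have "(\<Sum>s\<in>UNIV. w s * g s) < (\<Sum>s\<in>(UNIV :: 'i set). 0)"
        by (rule sum_strict_mono) (simp_all add: neg)
      then show False using wg by simp
    qed
    \<comment> \<open>Maximum principle: the terms of this sum are nonnegative, while 1 \<le>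
      \<kappa> makes the sum nonpositive. As \<open>N\<close> is positive, \<open>g\<close> is
      constant, hence zero because its \<open>w\<close>-mean vanishes.\<close>
    have "(\<Sum>t\<in>UNIV. N a t * (g a - g t)) = w a * g a - \<kappa> * w a * g a"
      by (simp add: right_diff_distrib sum_subtractf Ng w_def sum_distrib_right)
    also have "\<dots> = (1 - \<kappa>) * (w a * g a)" by (simp add: algebra_simps)
    also have "\<dots> \<le> 0" using \<kappa>1 w[of a] ga by (intro mult_nonpos_nonneg) auto
    finally have "(\<Sum>t\<in>UNIV. N a t * (g a - g t)) \<le> 0" .
    moreover have nonneg: "0 \<le> N a t * (g a - g t)" for t
      using a[of t] pos[of a t] by simp
    ultimately have "(\<Sum>t\<in>UNIV. N a t * (g a - g t)) = 0"
      by (intro antisym sum_nonneg) simp_all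
    then have "\<forall>t\<in>UNIV. N a t * (g a - g t) = 0"
      by (subst (asm) sum_nonneg_eq_0_iff) (simp_all add: nonneg)
    then have const: "g t = g a" for t using pos[of a t] by (metis UNIV_I mult_eq_0_iff right_minus_eq less_irrefl)
    have "(\<Sum>s\<in>UNIV. w s) * g a = (\<Sum>s\<in>UNIV. w s * g s)"
      unfolding sum_distrib_right by (intro sum.cong refl arg_cong[OF const[symmetric]])
    moreover have "0 < (\<Sum>s\<in>UNIV. w s)" using w by (intro sum_pos) auto
    ultimately have "g a = 0" using wg by simp
    then have "g s = 0" for s using const[of s] by simp
    then show False using wg2 by simp
  qed
  show ?thesis
    unfolding lorentz_def
  proof
    fix g
    let ?o = "\<lambda>_::'i. 1::real"
    have o: "bform N ?o ?o = sum w UNIV" by (simp add: bform_def w_def)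
    have og: "bform N ?o g = (\<Sum>s\<in>UNIV. w s * g s)" by (simp add: bform_one_left[OF sym] w_def)
    have opos: "0 < sum w UNIV" using w by (intro sum_pos) auto
    \<comment> \<open>\<open>c\<close> is minus the \<open>w\<close>-mean of \<open>g\<close>, so
      that \<open>k\<close> has \<open>w\<close>-mean zero.\<close>
    define c where "c = - (bform N ?o g / sum w UNIV)"
    define k where "k s = g s + c * ?o s" for s
    have "(\<Sum>s\<in>UNIV. w s * k s) = bform N ?o g + c * sum w UNIV"
      by (simp add: k_def og algebra_simps sum.distrib sum_distrib_left)
    then have "(\<Sum>s\<in>UNIV. w s * k s) = 0" using opos by (simp add: c_def)
    from neg[OF this] have "bform N k k \<le> 0" .
    moreover have "bform N k k = bform N g g + 2 * c * bform N ?o g + c\<^sup>2 * sum w UNIV"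
    proof -
      have "bform N k k = bform N k g + c * bform N k ?o" unfolding k_def[of "_"] by (subst bform_add_scale_right) simp
      also have "bform N k g = bform N g g + c * bform N g ?o"
        by (subst bform_commute[OF sym]) (simp add: k_def[abs_def] bform_add_scale_right[of N g g c ?o, simplified])
      also have "bform N k ?o = bform N ?o g + c * bform N ?o ?o"
        by (subst bform_commute[OF sym]) (simp add: k_def[abs_def] bform_add_scale_right[of N ?o g c ?o, simplified])
      finally show ?thesis using bform_commute[OF sym, where f = g and g = ?o]
        by (simp add: o power2_eq_square algebra_simps)
    qed
    ultimately have "sum w UNIV * (bform N g g + 2 * c * bform N ?o g + c\<^sup>2 * sum w UNIV) \<le> 0"
      using opos by (simp add: mult_nonneg_nonpos)
    moreover have "sum w UNIV * (bform N g g + 2 * c * bform N ?o g + c\<^sup>2 * sum w UNIV)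
        = sum w UNIV * bform N g g - (bform N ?o g)\<^sup>2"
      using opos by (simp add: c_def power2_eq_square field_simps)
    ultimately show "bform N ?o ?o * bform N g g \<le> (bform N ?o g)\<^sup>2" by (simp add: o)
  qed
qed

text \<open>With \<open>R\<close> read as the law of a pair of spins, the right hand side is its mutual information.\<close>
lemma lorentz_mutual_information:
  fixes M R :: "'i::finite \<Rightarrow> 'i \<Rightarrow> real"
  assumes M: "\<And>s t. M s t = M t s" "\<And>s t. 0 < M s t" "lorentz M"
    and R: "\<And>s t. R s t = R t s" "\<And>s t. 0 < R s t" "(\<Sum>s\<in>UNIV. \<Sum>t\<in>UNIV. R s t) = 1"
    and q: "\<And>s. q s = (\<Sum>t\<in>UNIV. M s t)" and r: "\<And>s. r s = (\<Sum>t\<in>UNIV. R s t)"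
    and S: "S = (\<Sum>s\<in>UNIV. q s)"
  shows "(\<Sum>s\<in>UNIV. \<Sum>t\<in>UNIV. R s t * ln (M s t * S / (q s * q t)))
    \<le> (\<Sum>s\<in>UNIV. \<Sum>t\<in>UNIV. R s t * ln (R s t / (r s * r t)))"
proof -
  have qpos: "0 < q s" for s unfolding q using M(2) by (intro sum_pos) auto
  have rpos: "0 < r s" for s unfolding r using R(2) by (intro sum_pos) auto
  have Spos: "0 < S" unfolding S using qpos by (intro sum_pos) auto
  \<comment> \<open>The density \<open>y\<close> of \<open>r\<close> with respect to
    \<open>q\<close> is the test function for \<open>lorentz M\<close>.\<close>
  define y where "y s = r s / q s" for s
  have "S * bform M y y \<le> (bform M (\<lambda>_. 1) y)\<^sup>2"
    using M(3) by (simp add: lorentz_def bform_def S q)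
  also have "bform M (\<lambda>_. 1) y = (\<Sum>s\<in>UNIV. q s * y s)"
    by (simp add: bform_one_left[OF M(1)] q)
  also have "\<dots> = (\<Sum>s\<in>UNIV. r s)" using qpos by (intro sum.cong) (auto simp: y_def less_imp_neq[symmetric])
  also have "\<dots> = 1" using R(3) by (simp add: r)
  finally have le1: "S * bform M y y \<le> 1" by simp
  \<comment> \<open>The tangent bound of \<open>ln\<close> at 1 is applied to the quotient of the
    two arguments; the right-hand sides add up to \<open>S * bform M y y - 1\<close>, which is
    nonpositive.\<close>
  have "R s t * ln (M s t * S / (q s * q t)) - R s t * ln (R s t / (r s * r t))
      \<le> S * (M s t * y s * y t) - R s t" for s t
  proof -
    define u where "u = M s t * S / (q s * q t)"
    define v where "v = R s t / (r s * r t)"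
    have uv: "0 < u" "0 < v" using M(2) R(2) Spos qpos rpos by (auto simp: u_def v_def)
    have "ln u - ln v = ln (u / v)" using uv by (simp add: ln_div)
    also have "\<dots> \<le> u / v - 1" using uv by (intro ln_le_minus_one) simp
    finally have "R s t * (ln u - ln v) \<le> R s t * (u / v - 1)"
      using R(2)[of s t] by (intro mult_left_mono) auto
    also have "R s t * (u / v - 1) = S * (M s t * y s * y t) - R s t"
      using R(2)[of s t] rpos[of s] rpos[of t] qpos[of s] qpos[of t]
      by (simp add: u_def v_def y_def field_simps)
    finally show ?thesis by (simp add: u_def v_def right_diff_distrib)
  qed
  then have "(\<Sum>s\<in>UNIV. \<Sum>t\<in>UNIV. R s t * ln (M s t * S / (q s * q t)) - R s t * ln (R s t / (r s * r t)))
      \<le> (\<Sum>s\<in>UNIV. \<Sum>t\<in>UNIV. S * (M s t * y s * y t) - R s t)"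
    by (intro sum_mono)
  also have "\<dots> = S * bform M y y - 1"
    by (simp add: sum_subtractf R(3) bform_def sum_distrib_left)
  finally show ?thesis using le1 by (simp add: sum_subtractf)
qed

section \<open>Clique partition functions and pair laws\<close>

locale positive_model =
  fixes h :: "'i::finite \<Rightarrow> 'i \<Rightarrow> real"
  assumes h_sym: "h s t = h t s" and h_pos: "0 < h s t"
    and h_lorentz: "\<forall>i. 0 < f i \<Longrightarrow> bform h f f * bform h g g \<le> (bform h f g)\<^sup>2"
begin

text \<open>\<open>pin x s\<close> is the external field left on a vertex with field \<open>x\<close> once a neighbour has spin
  \<open>s\<close>, and \<open>clique n x\<close> is the partition function of \<open>K\<^sub>n\<close> with field \<open>x\<close> at every vertex.\<close>
definition pin :: "('i \<Rightarrow> real) \<Rightarrow> 'i \<Rightarrow> 'i \<Rightarrow> real" where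
  "pin x s = (\<lambda>t. x t * h s t)"

primrec clique :: "nat \<Rightarrow> ('i \<Rightarrow> real) \<Rightarrow> real" where
  "clique 0 x = 1"
| "clique (Suc n) x = (\<Sum>s\<in>UNIV. x s * clique n (pin x s))"

lemma pin_commute: "pin (pin x s) t = pin (pin x t) s"
  by (simp add: pin_def mult_ac)

lemma pin_pos: "\<forall>i. 0 < x i \<Longrightarrow> \<forall>t. 0 < pin x s t"
  by (simp add: pin_def h_pos)

lemma clique_pos: "\<forall>i. 0 < x i \<Longrightarrow> 0 < clique n x"
proof (induction n arbitrary: x)
  case (Suc n)
  then show ?case by (auto intro!: sum_pos mult_pos_pos simp: pin_pos)
qed simp

text \<open>The unnormalised law of the spins of two vertices of \<open>K\<^sub>n\<close> for \<open>n = k + 2\<close>.\<close>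
definition pair :: "nat \<Rightarrow> ('i \<Rightarrow> real) \<Rightarrow> 'i \<Rightarrow> 'i \<Rightarrow> real" where
  "pair k x s t = x s * x t * h s t * clique k (pin (pin x s) t)"

lemma pair_sym: "pair k x s t = pair k x t s"
  by (simp add: pair_def h_sym[of t s] pin_commute[of x t s])

lemma pair_pos: "\<forall>i. 0 < x i \<Longrightarrow> 0 < pair k x s t"
  by (simp add: pair_def h_pos clique_pos pin_pos)

lemma sum_pair: "(\<Sum>t\<in>UNIV. pair k x s t) = x s * clique (Suc k) (pin x s)"
  by (simp add: pair_def sum_distrib_left pin_def mult_ac)

lemma sum_sum_pair: "(\<Sum>s\<in>UNIV. \<Sum>t\<in>UNIV. pair k x s t) = clique (Suc (Suc k)) x"
  by (simp only: sum_pair clique.simps(2)[of "Suc k"])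

text \<open>Summing over the spin \<open>r\<close> of a third vertex last exhibits the pair law as a
  mixture of pair laws of smaller cliques with pinned fields.\<close>

lemma pair_Suc: "pair (Suc k) x s t = (\<Sum>r\<in>UNIV. x r * pair k (pin x r) s t)"
proof -
  have "x s * x t * h s t * (pin (pin x s) t r * clique k (pin (pin (pin x s) t) r))
      = x r * pair k (pin x r) s t" for r
    unfolding pair_def pin_def h_sym[of r s] h_sym[of r t] by (simp add: mult_ac)
  then show ?thesis by (simp add: pair_def[of "Suc k"] sum_distrib_left)
qed

text \<open>Induction on \<open>k\<close>. In the base case the field \<open>x\<close> is absorbed
  into the test functions, which is why \<open>h_lorentz\<close> admits every positive
  \<open>f\<close>. In the step, the inequality for each clique pinned by a third spin
  \<open>r\<close> supplies the hypothesis of \<open>lorentz_trickle_down\<close>.\<close>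

lemma lorentz_pair:
  assumes "\<forall>i. 0 < x i"
  shows "lorentz (pair k x)"
  using assms
proof (induction k arbitrary: x)
  case 0
  have "bform (pair 0 x) f g = bform h (\<lambda>s. x s * f s) (\<lambda>s. x s * g s)" for f g
    by (simp add: bform_def pair_def mult_ac)
  then show ?case using h_lorentz[of x] 0 by (simp add: lorentz_def)
next
  case (Suc k)
  show ?case
  proof (rule lorentz_trickle_down)
    fix g
    have pos: "0 < clique (Suc (Suc k)) (pin x r)" for r
      by (intro clique_pos pin_pos Suc.prems)
    have "bform (pair (Suc k) x) g g = (\<Sum>r\<in>UNIV. x r * bform (pair k (pin x r)) g g)"
      unfolding bform_def pair_Suc sum_distrib_left sum_distrib_right
      by (subst sum.swap[of _ UNIV UNIV], subst (2) sum.swap) (simp add: mult_ac)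
    also have "\<dots> \<le> (\<Sum>r\<in>UNIV. (\<Sum>t\<in>UNIV. pair (Suc k) x r t * g t)\<^sup>2 / (\<Sum>t\<in>UNIV. pair (Suc k) x r t))"
    proof (rule sum_mono)
      fix r
      let ?N = "pair k (pin x r)"
      have lor: "lorentz ?N" using Suc by (simp add: pin_pos)
      have one: "bform ?N (\<lambda>_. 1) (\<lambda>_. 1) = clique (Suc (Suc k)) (pin x r)"
        by (simp only: bform_def mult_1_right sum_sum_pair)
      \<comment> \<open>Up to the factor \<open>x r\<close>, the marginal of the pinned pair matrix
        is row \<open>r\<close> of the larger pair matrix.\<close>
      have "x r * bform ?N (\<lambda>_. 1) g = (\<Sum>t\<in>UNIV. pair (Suc k) x r t * g t)"
      proof -
        have "x r * bform ?N (\<lambda>_. 1) g = (\<Sum>t\<in>UNIV. x r * (pin x r t * clique (Suc k) (pin (pin x r) t) * g t))"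
          by (simp only: bform_one_left[OF pair_sym] sum_pair sum_distrib_left)
        also have "\<dots> = (\<Sum>t\<in>UNIV. pair (Suc k) x r t * g t)"
          by (simp only: pair_def pin_def[of x] mult_ac)
        finally show ?thesis .
      qed
      then have "(\<Sum>t\<in>UNIV. pair (Suc k) x r t * g t)\<^sup>2 / (\<Sum>t\<in>UNIV. pair (Suc k) x r t)
          = x r * ((bform ?N (\<lambda>_. 1) g)\<^sup>2 / clique (Suc (Suc k)) (pin x r))"
        using Suc.prems[rule_format, of r] by (simp add: sum_pair power2_eq_square del: clique.simps flip: \<open>x r * _ = _\<close>)
      moreover have "bform ?N g g \<le> (bform ?N (\<lambda>_. 1) g)\<^sup>2 / clique (Suc (Suc k)) (pin x r)"
        using lor pos[of r] by (simp add: lorentz_def one pos_le_divide_eq mult.commute del: clique.simps)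
      ultimately show "x r * bform ?N g g \<le>
          (\<Sum>t\<in>UNIV. pair (Suc k) x r t * g t)\<^sup>2 / (\<Sum>t\<in>UNIV. pair (Suc k) x r t)"
        using mult_left_mono[of _ _ "x r"] Suc.prems[rule_format, of r] by (metis less_imp_le)
    qed
    finally show "bform (pair (Suc k) x) g g \<le> \<dots>" .
  qed (use pair_pos[OF Suc.prems] in \<open>auto intro: pair_sym\<close>)
qed


section \<open>Means under clique marginals\<close>

text \<open>The mean under the one-vertex marginal of \<open>K\<^sub>n\<^sub>+\<^sub>1\<close>, the index counting the other vertices.\<close>
definition avg :: "nat \<Rightarrow> ('i \<Rightarrow> real) \<Rightarrow> ('i \<Rightarrow> real) \<Rightarrow> real" where
  "avg n x f = (\<Sum>s\<in>UNIV. x s * clique n (pin x s) * f s) / clique (Suc n) x"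

lemma avg_add: "avg n x (\<lambda>s. f s + g s) = avg n x f + avg n x g"
  by (simp add: avg_def distrib_left sum.distrib add_divide_distrib del: clique.simps)

lemma avg_diff: "avg n x (\<lambda>s. f s - g s) = avg n x f - avg n x g"
  by (simp add: avg_def right_diff_distrib sum_subtractf diff_divide_distrib del: clique.simps)

lemma avg_scale: "avg n x (\<lambda>s. c * f s) = c * avg n x f"
  by (simp add: avg_def sum_distrib_left mult_ac del: clique.simps)

lemma avg_divide: "avg n x (\<lambda>s. f s / c) = avg n x f / c"
  using avg_scale[of n x "1 / c" f] by simp

lemma avg_zero: "avg n x (\<lambda>_. 0) = 0"
  by (simp add: avg_def)

lemma avg_const:
  assumes "\<forall>i. 0 < x i"
  shows "avg n x (\<lambda>_. c) = c"
  using clique_pos[OF assms, of "Suc n"] by (simp add: avg_def less_imp_neq[symmetric] flip: sum_distrib_right)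

lemma avg_sum: "avg n x (\<lambda>s. \<Sum>u\<in>U. f u s) = (\<Sum>u\<in>U. avg n x (f u))"
  by (induction U rule: infinite_finite_induct) (simp_all add: avg_add avg_zero)

lemma avg_mono:
  assumes "\<forall>i. 0 < x i" "\<forall>s. f s \<le> g s"
  shows "avg n x f \<le> avg n x g"
  unfolding avg_def
  by (intro divide_right_mono sum_mono mult_left_mono mult_nonneg_nonneg less_imp_le[OF clique_pos] pin_pos)
    (use assms in \<open>auto simp: less_imp_le\<close>)

text \<open>Jensen's inequality, from the tangent bound of \<open>ln\<close> at the mean.\<close>

lemma avg_ln_le:
  assumes x: "\<forall>i. 0 < x i" and f: "\<And>s. 0 < f s"
  shows "avg n x (\<lambda>s. ln (f s)) \<le> ln (avg n x f)"
proof -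
  have A: "0 < avg n x f" unfolding avg_def
    by (intro divide_pos_pos sum_pos mult_pos_pos clique_pos pin_pos x[rule_format] x f) auto
  have "\<forall>s. ln (f s) \<le> (f s / avg n x f - 1) + ln (avg n x f)"
  proof
    fix s
    show "ln (f s) \<le> (f s / avg n x f - 1) + ln (avg n x f)"
      using ln_le_minus_one[of "f s / avg n x f"] f[of s] A by (simp add: ln_div)
  qed
  from avg_mono[OF x this, of n]
  show ?thesis using A by (simp add: avg_add avg_diff avg_divide avg_const[OF x])
qed

text \<open>Nested means reveal two vertices one after the other; their weights multiply to the
  normalised pair law.\<close>

lemma avg_avg:
  assumes "\<forall>i. 0 < x i"
  shows "avg (Suc n) x (\<lambda>s. avg n (pin x s) (F s))
    = (\<Sum>s\<in>UNIV. \<Sum>t\<in>UNIV. pair n x s t * F s t) / clique (Suc (Suc n)) x"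
proof -
  have "x s * clique (Suc n) (pin x s) * avg n (pin x s) (F s) = (\<Sum>t\<in>UNIV. pair n x s t * F s t)" for s
  proof -
    have "0 < clique (Suc n) (pin x s)" by (intro clique_pos pin_pos assms)
    then have "x s * clique (Suc n) (pin x s) * avg n (pin x s) (F s)
        = x s * (\<Sum>t\<in>UNIV. pin x s t * clique n (pin (pin x s) t) * F s t)"
      by (simp add: avg_def del: clique.simps)
    then show ?thesis by (simp add: pair_def pin_def[of x] sum_distrib_left mult_ac)
  qed
  then show ?thesis by (simp add: avg_def[of "Suc n"] del: clique.simps)
qed

lemma avg_swap:
  assumes "\<forall>i. 0 < x i"
  shows "avg (Suc n) x (\<lambda>s. avg n (pin x s) (F s)) = avg (Suc n) x (\<lambda>s. avg n (pin x s) (\<lambda>t. F t s))"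
  unfolding avg_avg[OF assms] by (subst sum.swap) (simp only: pair_sym)

lemma avg_drop:
  assumes "\<forall>i. 0 < x i"
  shows "avg (Suc n) x (\<lambda>s. avg n (pin x s) f) = avg (Suc n) x f"
  using avg_swap[OF assms, where F = "\<lambda>_. f"] by (simp add: avg_const pin_pos assms)

text \<open>Exchanging the first two of three revealed vertices makes \<open>r\<close> the second
  one, and the remaining function no longer depends on it.\<close>

lemma avg_drop2:
  assumes "\<forall>i. 0 < x i"
  shows "avg (Suc (Suc n)) x (\<lambda>r. avg (Suc n) (pin x r) (\<lambda>s. avg n (pin (pin x r) s) (F s)))
    = avg (Suc (Suc n)) x (\<lambda>s. avg (Suc n) (pin x s) (F s))"
proof -
  have "avg (Suc (Suc n)) x (\<lambda>r. avg (Suc n) (pin x r) (\<lambda>s. avg n (pin (pin x r) s) (F s)))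
      = avg (Suc (Suc n)) x (\<lambda>s. avg (Suc n) (pin x s) (\<lambda>r. avg n (pin (pin x s) r) (F s)))"
    by (subst avg_swap[OF assms]) (simp only: pin_commute[of x])
  then show ?thesis by (simp add: avg_drop pin_pos assms)
qed

section \<open>Finite differences of mean log-partition functions\<close>

text \<open>Up to the common mean of \<open>ln (h s t)\<close>, the two sides of \<open>lorentz_mutual_information\<close> for the
  pair law of \<open>K\<^sub>n\<^sub>+\<^sub>2\<close> with field \<open>x\<close> and the pair matrix of \<open>K\<^sub>k\<^sub>+\<^sub>2\<close> with field \<open>z\<close>.\<close>
lemma ln_clique_second_difference:
  assumes x: "\<forall>i. 0 < x i" and z: "\<forall>i. 0 < z i"
  shows "ln (clique (k + 2) z) - 2 * avg (n + 1) x (\<lambda>s. ln (clique (k + 1) (pin z s)))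
      + avg (n + 1) x (\<lambda>s. avg n (pin x s) (\<lambda>t. ln (clique k (pin (pin z s) t))))
    \<le> ln (clique (n + 2) x) - 2 * avg (n + 1) x (\<lambda>s. ln (clique (n + 1) (pin x s)))
      + avg (n + 1) x (\<lambda>s. avg n (pin x s) (\<lambda>t. ln (clique n (pin (pin x s) t))))"
proof -
  define A where "A F = avg (Suc n) x (\<lambda>s. avg n (pin x s) (F s))" for F
  \<comment> \<open>\<open>L m y s t\<close> is the logarithm of joint probability over product of
    marginals for two vertices of \<open>K\<^sub>m\<^sub>+\<^sub>2\<close> with field
    \<open>y\<close>; the factors \<open>y s\<close> and \<open>y t\<close> cancel.\<close>
  define L where "L m y s t = ln (h s t) + ln (clique (m + 2) y) + ln (clique m (pin (pin y s) t))
      - ln (clique (m + 1) (pin y s)) - ln (clique (m + 1) (pin y t))" for m y s t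
  have ln_pair: "ln (pair m y s t * clique (Suc (Suc m)) y
      / ((y s * clique (Suc m) (pin y s)) * (y t * clique (Suc m) (pin y t)))) = L m y s t"
    if y: "\<forall>i. 0 < y i" for m y s t
  proof -
    have "0 < clique (Suc (Suc m)) y" "0 < clique (Suc m) (pin y s)" "0 < clique (Suc m) (pin y t)"
      "0 < clique m (pin (pin y s) t)" "0 < h s t" "0 < y s" "0 < y t"
      using y by (auto intro!: clique_pos pin_pos h_pos simp del: clique.simps)
    then show ?thesis by (simp add: L_def pair_def ln_mult ln_div del: clique.simps)
  qed
  have Cpos: "0 < clique (Suc (Suc n)) x" by (intro clique_pos x)
  define R where "R s t = pair n x s t / clique (Suc (Suc n)) x" for s t
  have A_R: "A F = (\<Sum>s\<in>UNIV. \<Sum>t\<in>UNIV. R s t * F s t)" for F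
    by (simp add: A_def avg_avg[OF x] R_def sum_divide_distrib del: clique.simps)
  have R_sum: "(\<Sum>t\<in>UNIV. R s t) = x s * clique (Suc n) (pin x s) / clique (Suc (Suc n)) x" for s
    by (simp only: R_def sum_divide_distrib[symmetric] sum_pair)
  have "A (L k z) \<le> A (L n x)"
  proof -
    have "(\<Sum>s\<in>UNIV. \<Sum>t\<in>UNIV. R s t * ln (pair k z s t * clique (Suc (Suc k)) z
        / ((z s * clique (Suc k) (pin z s)) * (z t * clique (Suc k) (pin z t)))))
      \<le> (\<Sum>s\<in>UNIV. \<Sum>t\<in>UNIV. R s t * ln (R s t /
          ((x s * clique (Suc n) (pin x s) / clique (Suc (Suc n)) x) *
           (x t * clique (Suc n) (pin x t) / clique (Suc (Suc n)) x))))"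
    proof (rule lorentz_mutual_information)
      show "(\<Sum>s\<in>UNIV. \<Sum>t\<in>UNIV. R s t) = 1"
        using Cpos by (simp add: R_def sum_sum_pair flip: sum_divide_distrib del: clique.simps)
      show "clique (Suc (Suc k)) z = (\<Sum>s\<in>UNIV. z s * clique (Suc k) (pin z s))" by simp
      show "x s * clique (Suc n) (pin x s) / clique (Suc (Suc n)) x = (\<Sum>t\<in>UNIV. R s t)" for s
        by (rule R_sum[symmetric])
      show "R s t = R t s" for s t by (simp only: R_def pair_sym)
      show "0 < R s t" for s t unfolding R_def by (intro divide_pos_pos Cpos pair_pos x)
    qed (simp_all only: sum_pair pair_sym lorentz_pair[OF z] pair_pos[OF z])
    also have "\<dots> = (\<Sum>s\<in>UNIV. \<Sum>t\<in>UNIV. R s t * ln (pair n x s t * clique (Suc (Suc n)) x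
        / ((x s * clique (Suc n) (pin x s)) * (x t * clique (Suc n) (pin x t)))))"
    proof -
      have "R s t / ((x s * clique (Suc n) (pin x s) / clique (Suc (Suc n)) x) *
           (x t * clique (Suc n) (pin x t) / clique (Suc (Suc n)) x))
        = pair n x s t * clique (Suc (Suc n)) x
          / ((x s * clique (Suc n) (pin x s)) * (x t * clique (Suc n) (pin x t)))" for s t
        using Cpos by (simp add: R_def field_simps del: clique.simps)
      then show ?thesis by (simp only:)
    qed
    finally show ?thesis by (simp only: A_R ln_pair[OF x] ln_pair[OF z])
  qed
  \<comment> \<open>By exchangeability the two marginal terms have the same mean, whence the factor
    2.\<close>
  moreover have "A (L m y) = A (\<lambda>s t. ln (h s t)) + ln (clique (m + 2) y)
      + A (\<lambda>s t. ln (clique m (pin (pin y s) t)))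
      - 2 * avg (n + 1) x (\<lambda>s. ln (clique (m + 1) (pin y s)))" for m y
  proof -
    have "A (\<lambda>s t. ln (clique (m + 1) (pin y t))) = avg (n + 1) x (\<lambda>s. ln (clique (m + 1) (pin y s)))"
      by (simp add: A_def avg_drop x del: clique.simps)
    moreover have "A (\<lambda>s t. ln (clique (m + 1) (pin y s))) = avg (n + 1) x (\<lambda>s. ln (clique (m + 1) (pin y s)))"
      by (simp add: A_def avg_const x pin_pos del: clique.simps)
    moreover have "A (\<lambda>s t. ln (clique (m + 2) y)) = ln (clique (m + 2) y)"
      by (simp add: A_def avg_const x pin_pos del: clique.simps)
    moreover have "A (L m y) = A (\<lambda>s t. ln (h s t)) + A (\<lambda>s t. ln (clique (m + 2) y))
      + A (\<lambda>s t. ln (clique m (pin (pin y s) t)))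
      - A (\<lambda>s t. ln (clique (m + 1) (pin y s))) - A (\<lambda>s t. ln (clique (m + 1) (pin y t)))"
      unfolding A_def L_def avg_add avg_diff ..
    ultimately show ?thesis by simp
  qed
  ultimately show ?thesis by (simp add: A_def del: clique.simps)
qed

text \<open>The previous lemma, averaged over \<open>r\<close>, for the fields \<open>pin x r\<close> and \<open>x\<close>: pinning a spin increases
  the mutual information of two others.\<close>
lemma ln_clique_third_difference:
  assumes x: "\<forall>i. 0 < x i"
  shows "ln (clique (n + 3) x) \<le> 3 * avg (n + 2) x (\<lambda>s. ln (clique (n + 2) (pin x s)))
    - 3 * avg (n + 2) x (\<lambda>s. avg (n + 1) (pin x s) (\<lambda>t. ln (clique (n + 1) (pin (pin x s) t))))
    + avg (n + 2) x (\<lambda>r. avg (n + 1) (pin x r) (\<lambda>s. avg n (pin (pin x r) s)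
        (\<lambda>t. ln (clique n (pin (pin (pin x r) s) t)))))"
proof -
  have "\<forall>r. ln (clique (n + 3) x) - 2 * avg (n + 1) (pin x r) (\<lambda>s. ln (clique (n + 2) (pin x s)))
      + avg (n + 1) (pin x r) (\<lambda>s. avg n (pin (pin x r) s) (\<lambda>t. ln (clique (n + 1) (pin (pin x s) t))))
    \<le> ln (clique (n + 2) (pin x r)) - 2 * avg (n + 1) (pin x r) (\<lambda>s. ln (clique (n + 1) (pin (pin x r) s)))
      + avg (n + 1) (pin x r) (\<lambda>s. avg n (pin (pin x r) s) (\<lambda>t. ln (clique n (pin (pin (pin x r) s) t))))"
    using ln_clique_second_difference[OF pin_pos[OF x] x, of "n + 1" n]
    by (simp add: numeral_eq_Suc del: clique.simps)
  from avg_mono[OF x this, of "Suc (Suc n)"]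
  show ?thesis
    by (simp add: avg_add avg_diff avg_scale avg_const x avg_drop avg_drop2 numeral_eq_Suc del: clique.simps)
qed

text \<open>As the vertices of a clique are revealed one at a time, the mean log-partition function
  per remaining vertex is concave. The third-difference bound involves four consecutive levels; the
  inductive hypothesis, averaged over the first revealed spin, eliminates the lowest. The induction
  starts because \<open>ln (clique 0 x)\<close> is zero.\<close>

lemma ln_clique_mean_concave:
  assumes x: "\<forall>i. 0 < x i"
  shows "ln (clique (n + 3) x) / (n + 3) - 2 * (avg (n + 2) x (\<lambda>s. ln (clique (n + 2) (pin x s))) / (n + 2))
    + avg (n + 2) x (\<lambda>s. avg (n + 1) (pin x s) (\<lambda>t. ln (clique (n + 1) (pin (pin x s) t)))) / (n + 1) \<le> 0"
  using x
proof (induction n arbitrary: x)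
  case 0
  then show ?case using ln_clique_third_difference[of x 0]
    by (simp add: avg_zero field_simps del: clique.simps(2))
next
  case (Suc n)
  define B0 where "B0 = ln (clique (n + 4) x)"
  define B1 where "B1 = avg (n + 3) x (\<lambda>s. ln (clique (n + 3) (pin x s)))"
  define B2 where "B2 = avg (n + 3) x (\<lambda>s. avg (n + 2) (pin x s) (\<lambda>t. ln (clique (n + 2) (pin (pin x s) t))))"
  define B3 where "B3 = avg (n + 3) x (\<lambda>r. avg (n + 2) (pin x r) (\<lambda>s. avg (n + 1) (pin (pin x r) s)
        (\<lambda>t. ln (clique (n + 1) (pin (pin (pin x r) s) t)))))"
  have third: "B0 \<le> 3 * B1 - 3 * B2 + B3"
    using ln_clique_third_difference[OF Suc.prems, of "Suc n"]
    by (simp add: B0_def B1_def B2_def B3_def numeral_eq_Suc del: clique.simps)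
  have "\<forall>r. ln (clique (n + 3) (pin x r)) / (n + 3)
      - 2 * (avg (n + 2) (pin x r) (\<lambda>s. ln (clique (n + 2) (pin (pin x r) s))) / (n + 2))
      + avg (n + 2) (pin x r) (\<lambda>s. avg (n + 1) (pin (pin x r) s)
          (\<lambda>t. ln (clique (n + 1) (pin (pin (pin x r) s) t)))) / (n + 1) \<le> 0"
    using Suc.IH[OF pin_pos[OF Suc.prems]] by blast
  from avg_mono[OF Suc.prems this, of "n + 3"]
  have "B1 / (n + 3) - 2 * (B2 / (n + 2)) + B3 / (n + 1) \<le> 0"
    by (simp only: avg_add avg_diff avg_scale avg_divide avg_zero B1_def B2_def B3_def)
  then have "B3 / (n + 1) \<le> 2 * (B2 / (n + 2)) - B1 / (n + 3)" by linarith
  then have "B3 \<le> (n + 1) * (2 * (B2 / (n + 2)) - B1 / (n + 3))"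
    by (subst (asm) pos_divide_le_eq) (auto simp: mult.commute)
  with third have "B0 \<le> 3 * B1 - 3 * B2 + (n + 1) * (2 * (B2 / (n + 2)) - B1 / (n + 3))"
    by linarith
  \<comment> \<open>In the per-vertex quantities \<open>B1 / (n + 3)\<close> and
    \<open>B2 / (n + 2)\<close> the bound acquires the common factor \<open>n + 4\<close>.\<close>
  also have "\<dots> = 3 * ((n + 3) * (B1 / (n + 3))) - 3 * ((n + 2) * (B2 / (n + 2)))
      + (n + 1) * (2 * (B2 / (n + 2)) - B1 / (n + 3))" by simp
  also have "\<dots> = (n + 4) * (2 * (B1 / (n + 3)) - B2 / (n + 2))"
  proof -
    have "3 * ((r + 3) * a) - 3 * ((r + 2) * b) + (r + 1) * (2 * b - a) = (r + 4) * (2 * a - b)" for r a b :: real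
      by (simp add: algebra_simps)
    from this[of "real n" "B1 / (n + 3)" "B2 / (n + 2)"] show ?thesis
      by (simp only: of_nat_add of_nat_numeral of_nat_1)
  qed
  finally have "B0 / (n + 4) \<le> 2 * (B1 / (n + 3)) - B2 / (n + 2)"
    by (subst pos_divide_le_eq) (auto simp: mult.commute)
  then show ?case by (simp add: B0_def B1_def B2_def numeral_eq_Suc add_ac del: clique.simps)
qed

text \<open>Induction on \<open>k\<close>, pinning in both cliques the same spin, drawn from the
  Gibbs measure with field \<open>x\<close>. The second-difference inequality relates the top level
  to the two below, the inductive hypothesis compares those two, and concavity absorbs the
  difference of the clique sizes.\<close>

lemma ln_clique_mean_compare:
  assumes "k \<le> n" and x: "\<forall>i. 0 < x i" and z: "\<forall>i. 0 < z i"
  shows "avg (n + 1) x (\<lambda>s. ln (clique (n + 1) (pin x s))) / (n + 1)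
      - avg (n + 1) x (\<lambda>s. ln (clique (k + 1) (pin z s))) / (k + 1)
    \<le> ln (clique (n + 2) x) / (n + 2) - ln (clique (k + 2) z) / (k + 2)"
  using assms
proof (induction k arbitrary: n x z)
  case 0
  define B0 where "B0 = ln (clique (n + 2) x)"
  define B1 where "B1 = avg (n + 1) x (\<lambda>s. ln (clique (n + 1) (pin x s)))"
  define B2 where "B2 = avg (n + 1) x (\<lambda>s. avg n (pin x s) (\<lambda>t. ln (clique n (pin (pin x s) t))))"
  define b0 where "b0 = ln (clique 2 z)"
  define b1 where "b1 = avg (n + 1) x (\<lambda>s. ln (clique 1 (pin z s)))"
  have second: "b0 - 2 * b1 \<le> B0 - 2 * B1 + B2"
    using ln_clique_second_difference[OF 0(2,3), of 0 n]
    by (simp add: avg_zero B0_def B1_def B2_def b0_def b1_def numeral_eq_Suc del: clique.simps(2))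
  \<comment> \<open>This is concavity multiplied by \<open>n\<close>; for \<open>n = 0\<close> both
    sides agree, as \<open>B2\<close> is then zero.\<close>
  have "(B0 - 2 * B1 + B2) / 2 \<le> B0 / (n + 2) - B1 / (n + 1)"
  proof (cases n)
    case 0
    then show ?thesis by (simp add: B2_def avg_zero del: clique.simps(2))
  next
    case (Suc m)
    have "B0 / (n + 2) - 2 * (B1 / (n + 1)) + B2 / n \<le> 0"
      using ln_clique_mean_concave[OF 0(2), of m]
      by (simp add: B0_def B1_def B2_def Suc numeral_eq_Suc add_ac del: clique.simps)
    then have "n * (B0 / (n + 2) - 2 * (B1 / (n + 1)) + B2 / n) \<le> 0"
      by (intro mult_nonneg_nonpos) auto
    moreover have "n * (B2 / n) = B2" using Suc by simp
    ultimately have "n * (B0 / (n + 2)) - 2 * (n * (B1 / (n + 1))) + B2 \<le> 0"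
      by (simp only: right_diff_distrib distrib_left mult.left_commute[of "real n" 2])
    moreover have "n * (B0 / (n + 2)) = B0 - 2 * (B0 / (n + 2))" by (simp add: field_simps)
    moreover have "n * (B1 / (n + 1)) = B1 - B1 / (n + 1)" by (simp add: field_simps)
    ultimately show ?thesis by argo
  qed
  then have "B1 / (n + 1) - b1 \<le> B0 / (n + 2) - b0 / 2" using second by argo
  then show ?case by (simp add: B0_def B1_def b0_def b1_def numeral_eq_Suc del: clique.simps)
next
  case (Suc k)
  then obtain m where n: "n = Suc m" "k \<le> m" by (cases n) auto
  note x = Suc.prems(2) and z = Suc.prems(3)
  define \<beta>0 where "\<beta>0 = ln (clique (m + 3) x) / (m + 3)"
  define \<beta>1 where "\<beta>1 = avg (m + 2) x (\<lambda>s. ln (clique (m + 2) (pin x s))) / (m + 2)"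
  define \<beta>2 where "\<beta>2 = avg (m + 2) x (\<lambda>s. avg (m + 1) (pin x s) (\<lambda>t. ln (clique (m + 1) (pin (pin x s) t)))) / (m + 1)"
  define \<gamma>0 where "\<gamma>0 = ln (clique (k + 3) z) / (k + 3)"
  define \<gamma>1 where "\<gamma>1 = avg (m + 2) x (\<lambda>s. ln (clique (k + 2) (pin z s))) / (k + 2)"
  define \<gamma>2 where "\<gamma>2 = avg (m + 2) x (\<lambda>s. avg (m + 1) (pin x s) (\<lambda>t. ln (clique (k + 1) (pin (pin z s) t)))) / (k + 1)"
  have second: "(k + 3) * \<gamma>0 - 2 * ((k + 2) * \<gamma>1) + (k + 1) * \<gamma>2
      \<le> (m + 3) * \<beta>0 - 2 * ((m + 2) * \<beta>1) + (m + 1) * \<beta>2"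
    using ln_clique_second_difference[OF x z, of "Suc k" "Suc m"]
    by (simp add: \<beta>0_def \<beta>1_def \<beta>2_def \<gamma>0_def \<gamma>1_def \<gamma>2_def numeral_eq_Suc del: clique.simps of_nat_Suc of_nat_add)
  have "\<forall>r. avg (m + 1) (pin x r) (\<lambda>s. ln (clique (m + 1) (pin (pin x r) s))) / (m + 1)
      - avg (m + 1) (pin x r) (\<lambda>s. ln (clique (k + 1) (pin (pin z r) s))) / (k + 1)
    \<le> ln (clique (m + 2) (pin x r)) / (m + 2) - ln (clique (k + 2) (pin z r)) / (k + 2)"
    using Suc.IH[OF n(2) pin_pos[OF x] pin_pos[OF z]] by blast
  from avg_mono[OF x this, of "m + 2"]
  have "\<beta>2 - \<gamma>2 \<le> \<beta>1 - \<gamma>1"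
    by (simp only: avg_add avg_diff avg_divide \<beta>1_def \<beta>2_def \<gamma>1_def \<gamma>2_def)
  then have "(k + 1) * (\<beta>2 - \<gamma>2) \<le> (k + 1) * (\<beta>1 - \<gamma>1)"
    by (intro mult_left_mono) auto
  \<comment> \<open>In \<open>second\<close> the coefficients on the right exceed those on the left
    by \<open>m - k\<close> times the pattern 1, -2, 1; concavity makes this excess
    nonpositive.\<close>
  moreover have "(real m - k) * (\<beta>0 - 2 * \<beta>1 + \<beta>2) \<le> 0"
    using ln_clique_mean_concave[OF x, of m] n(2)
    by (intro mult_nonneg_nonpos) (auto simp: \<beta>0_def \<beta>1_def \<beta>2_def simp del: clique.simps)
  ultimately have "(k + 3) * (\<beta>1 - \<gamma>1) \<le> (k + 3) * (\<beta>0 - \<gamma>0)"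
    using second by (simp add: algebra_simps)
  then have "\<beta>1 - \<gamma>1 \<le> \<beta>0 - \<gamma>0" by (simp add: mult_le_cancel_left)
  then show ?case
    by (simp add: n \<beta>0_def \<beta>1_def \<gamma>0_def \<gamma>1_def numeral_eq_Suc add_ac del: clique.simps)
qed

text \<open>The right hand side is what remains of the sum over the spin of a vertex with field \<open>x\<close> and
  neighbours \<open>U\<close> after the inequality has been applied to the graph without this vertex.\<close>
lemma clique_vertex_step:
  assumes U: "finite U" "\<And>u. u \<in> U \<Longrightarrow> 1 \<le> k u \<and> k u \<le> card U"
    and x: "\<forall>i. 0 < x i" and z: "\<And>u. \<forall>i. 0 < z u i"
  shows "clique (card U + 1) x powr (1 / real (card U + 1)) * (\<Prod>u\<in>U. clique (k u + 1) (z u) powr (1 / real (k u + 1)))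
    \<le> (\<Sum>s\<in>UNIV. x s * (\<Prod>u\<in>U. clique (k u) (pin (z u) s) powr (1 / real (k u))))"
proof -
  define d where "d = card U"
  define Y where "Y s = (\<Prod>u\<in>U. clique (k u) (pin (z u) s) powr (1 / real (k u)))" for s
  have cp: "0 < clique m x" "0 < clique m (pin x s)" "0 < clique m (z u)" "0 < clique m (pin (z u) s)" for m s u
    by (auto intro!: clique_pos pin_pos x z)
  have Y: "0 < Y s" for s unfolding Y_def by (intro prod_pos) (auto simp: cp(4) less_imp_neq[symmetric])
  have lnY: "ln (Y s) = (\<Sum>u\<in>U. ln (clique (k u) (pin (z u) s)) / k u)" for s
    unfolding Y_def by (subst ln_prod) (auto simp: ln_powr cp(4) less_imp_neq[symmetric] U)
  \<comment> \<open>Dividing out the marginal weight of the spin \<open>s\<close> turns the sum into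
    a mean, ready for Jensen's inequality.\<close>
  have eq: "(\<Sum>s\<in>UNIV. x s * Y s) = avg d x (\<lambda>s. clique (d + 1) x / clique d (pin x s) * Y s)"
    using cp(1)[of "Suc d"] less_imp_neq[OF cp(2)]
    by (simp add: avg_def sum_divide_distrib mult_ac del: clique.simps)
  have jensen: "avg d x (\<lambda>s. ln (clique (d + 1) x / clique d (pin x s) * Y s))
      \<le> ln (avg d x (\<lambda>s. clique (d + 1) x / clique d (pin x s) * Y s))"
    by (intro avg_ln_le x mult_pos_pos divide_pos_pos cp Y)
  have expand: "avg d x (\<lambda>s. ln (clique (d + 1) x / clique d (pin x s) * Y s))
     = ln (clique (d + 1) x) - avg d x (\<lambda>s. ln (clique d (pin x s)))
       + (\<Sum>u\<in>U. avg d x (\<lambda>s. ln (clique (k u) (pin (z u) s))) / k u)"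
  proof -
    have "ln (clique (d + 1) x / clique d (pin x s) * Y s)
        = ln (clique (d + 1) x) - ln (clique d (pin x s)) + (\<Sum>u\<in>U. ln (clique (k u) (pin (z u) s)) / k u)" for s
      using cp(1)[of "d + 1"] cp(2)[of d s] Y[of s] by (simp add: ln_mult ln_div lnY del: clique.simps)
    then show ?thesis by (simp only: avg_add avg_diff avg_const[OF x] avg_sum avg_divide)
  qed
  have compare: "ln (clique (d + 1) x) / (d + 1) + (\<Sum>u\<in>U. ln (clique (k u + 1) (z u)) / (k u + 1))
     \<le> ln (clique (d + 1) x) - avg d x (\<lambda>s. ln (clique d (pin x s)))
       + (\<Sum>u\<in>U. avg d x (\<lambda>s. ln (clique (k u) (pin (z u) s))) / k u)"
  proof (cases d)
    case 0
    then have "U = {}" using U(1) by (simp add: d_def)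
    then show ?thesis by (simp add: 0 avg_zero)
  next
    case (Suc n)
    define \<beta>0 where "\<beta>0 = ln (clique (d + 1) x) / (d + 1)"
    define \<beta>1 where "\<beta>1 = avg d x (\<lambda>s. ln (clique d (pin x s))) / d"
    \<comment> \<open>One comparison per neighbour. Since \<open>d * \<beta>0\<close> falls short of
      \<open>ln (clique (d + 1) x)\<close> by \<beta>0, the \<open>d\<close> comparisons together
      leave exactly the term of the removed vertex.\<close>
    have "\<beta>1 - \<beta>0 + ln (clique (k u + 1) (z u)) / (k u + 1)
        \<le> avg d x (\<lambda>s. ln (clique (k u) (pin (z u) s))) / k u" if "u \<in> U" for u
    proof -
      obtain j where j: "k u = Suc j" "j \<le> n" using U(2)[OF \<open>u \<in> U\<close>] Suc by (cases "k u") (auto simp: d_def)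
      show ?thesis using ln_clique_mean_compare[OF j(2) x z[of u]]
        by (simp add: \<beta>0_def \<beta>1_def j Suc numeral_eq_Suc add_ac del: clique.simps)
    qed
    then have "(\<Sum>u\<in>U. \<beta>1 - \<beta>0 + ln (clique (k u + 1) (z u)) / (k u + 1))
        \<le> (\<Sum>u\<in>U. avg d x (\<lambda>s. ln (clique (k u) (pin (z u) s))) / k u)"
      by (intro sum_mono)
    moreover have "(\<Sum>u\<in>U. \<beta>1 - \<beta>0 + ln (clique (k u + 1) (z u)) / (k u + 1))
        = d * \<beta>1 - d * \<beta>0 + (\<Sum>u\<in>U. ln (clique (k u + 1) (z u)) / (k u + 1))"
      by (simp add: sum.distrib d_def right_diff_distrib del: clique.simps)
    moreover have "d * \<beta>1 = avg d x (\<lambda>s. ln (clique d (pin x s)))" by (simp add: \<beta>1_def Suc del: of_nat_Suc)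
    moreover have "d * \<beta>0 = ln (clique (d + 1) x) - \<beta>0" by (simp add: \<beta>0_def field_simps del: clique.simps)
    ultimately show ?thesis by (simp add: \<beta>0_def del: clique.simps)
  qed
  have "ln (clique (d + 1) x powr (1 / real (d + 1)) * (\<Prod>u\<in>U. clique (k u + 1) (z u) powr (1 / real (k u + 1))))
      = ln (clique (d + 1) x) / (d + 1) + (\<Sum>u\<in>U. ln (clique (k u + 1) (z u)) / (k u + 1))"
    using cp(1)[of "d + 1"] cp(3)
    by (subst ln_mult_pos) (auto simp: ln_powr ln_prod U less_imp_neq[symmetric] intro!: prod_pos simp del: clique.simps)
  also note compare
  also note expand[symmetric]
  also note jensen
  finally have "ln (clique (d + 1) x powr (1 / real (d + 1)) * (\<Prod>u\<in>U. clique (k u + 1) (z u) powr (1 / real (k u + 1))))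
      \<le> ln (\<Sum>s\<in>UNIV. x s * Y s)" by (simp only: eq)
  moreover have "0 < clique (d + 1) x powr (1 / real (d + 1)) * (\<Prod>u\<in>U. clique (k u + 1) (z u) powr (1 / real (k u + 1)))"
    using cp(1)[of "d + 1"] cp(3) by (auto simp: less_imp_neq[symmetric] intro!: mult_pos_pos prod_pos simp del: clique.simps)
  moreover have "0 < (\<Sum>s\<in>UNIV. x s * Y s)" by (intro sum_pos mult_pos_pos x[rule_format] Y) auto
  ultimately show ?thesis by (simp add: Y_def d_def del: clique.simps)
qed

end

section \<open>Partition functions of graphs\<close>

lemma nsets_2_cases:
  assumes "e \<in> nsets V 2"
  obtains u v where "e = {u, v}" "u \<in> V" "v \<in> V" "u \<noteq> v"
  using assms by (auto simp: nsets_def card_2_iff)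

lemma edge_weight_cong:
  assumes "model H" "e \<in> nsets V 2" "\<And>v. v \<in> V \<Longrightarrow> \<phi> v = \<psi> v"
  shows "edge_weight H \<phi> e = edge_weight H \<psi> e"
  using assms(2) by (rule nsets_2_cases) (simp add: edge_weight_doubleton[OF assms(1)] assms(3))

lemma edges_at_vertex:
  assumes "v \<notin> V" "E \<subseteq> nsets (insert v V) 2"
  shows "{e \<in> E. v \<in> e} = (\<lambda>u. {u, v}) ` {u \<in> V. {u, v} \<in> E}"
proof
  show "{e \<in> E. v \<in> e} \<subseteq> (\<lambda>u. {u, v}) ` {u \<in> V. {u, v} \<in> E}"
  proof
    fix e assume e: "e \<in> {e \<in> E. v \<in> e}"
    then have "e \<in> nsets (insert v V) 2" using assms(2) by auto
    then obtain a b where "e = {a, b}" "a \<in> insert v V" "b \<in> insert v V" "a \<noteq> b"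
      by (rule nsets_2_cases)
    with e show "e \<in> (\<lambda>u. {u, v}) ` {u \<in> V. {u, v} \<in> E}"
      by (auto simp: insert_commute)
  qed
qed auto

lemma inj_on_doubleton: "inj_on (\<lambda>u. {u, v}) A"
  by (auto simp: inj_on_def doubleton_eq_iff)

lemma degree_in_eq_card_neighbours:
  assumes "v \<notin> V" "E \<subseteq> nsets (insert v V) 2"
  shows "degree_in E v = card {u \<in> V. {u, v} \<in> E}"
  unfolding degree_in_def edges_at_vertex[OF assms] by (rule card_image[OF inj_on_doubleton])

lemma finite_edges:
  assumes "finite V" "E \<subseteq> nsets V 2"
  shows "finite E"
  using assms by (metis finite_imp_finite_nsets finite_subset)

text \<open>The only possible edge through both \<open>u\<close> and \<open>v\<close> is
  \<open>{u, v}\<close>.\<close>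

lemma degree_in_delete_vertex:
  assumes "finite V" "v \<notin> V" "E \<subseteq> nsets (insert v V) 2" "u \<in> V"
  shows "degree_in E u = degree_in {e \<in> E. v \<notin> e} u + (if {u, v} \<in> E then 1 else 0)"
proof -
  have fin: "finite E" using finite_edges[of "insert v V" E] assms by simp
  have both: "e = {u, v}" if "e \<in> E" "u \<in> e" "v \<in> e" for e
  proof -
    have "e \<in> nsets (insert v V) 2" using assms(3) that(1) by auto
    then obtain a b where "e = {a, b}" by (rule nsets_2_cases)
    then show ?thesis using that assms(2,4) by auto
  qed
  show ?thesis
  proof (cases "{u, v} \<in> E")
    case True
    then have "{e \<in> E. u \<in> e} = insert {u, v} {e \<in> {e \<in> E. v \<notin> e}. u \<in> e}"
      using both by blast
    then show ?thesis using fin True by (simp add: degree_in_def)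
  next
    case False
    then have "{e \<in> E. u \<in> e} = {e \<in> {e \<in> E. v \<notin> e}. u \<in> e}"
      using both by blast
    then show ?thesis using False by (simp add: degree_in_def)
  qed
qed

section \<open>Graph partition functions with external fields\<close>

context positive_model
begin

definition H :: "real ^ 'i ^ 'i" where
  "H = (\<chi> s t. h s t)"

lemma model_H: "model H"
  by (simp add: model_def H_def transpose_def vec_eq_iff h_sym less_imp_le[OF h_pos])

lemma edge_weight_H: "edge_weight H \<phi> {u, v} = h (\<phi> u) (\<phi> v)"
  by (simp add: edge_weight_doubleton[OF model_H]) (simp add: H_def)

text \<open>Each vertex has its own field, since pinning a deleted vertex alters the fields of its
  neighbours only.\<close>

definition field_hom :: "'v set \<Rightarrow> 'v set set \<Rightarrow> ('v \<Rightarrow> 'i \<Rightarrow> real) \<Rightarrow> real" where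
  "field_hom V E l = (\<Sum>\<phi>\<in>V \<rightarrow>\<^sub>E UNIV. (\<Prod>v\<in>V. l v (\<phi> v)) * (\<Prod>e\<in>E. edge_weight H \<phi> e))"

lemma field_hom_cong:
  assumes "\<And>v. v \<in> V \<Longrightarrow> l v = l' v"
  shows "field_hom V E l = field_hom V E l'"
  using assms by (simp add: field_hom_def)

lemma field_hom_one: "field_hom V E (\<lambda>_ _. 1) = hom V E H"
  by (simp add: field_hom_def hom_def)

text \<open>With the spin \<open>s\<close> of \<open>v\<close> fixed, an edge from \<open>v\<close>
  to \<open>u\<close> becomes a factor \<open>h s (g u)\<close>, which \<open>pin\<close> moves into
  the field of \<open>u\<close>.\<close>

lemma field_hom_delete_vertex:
  assumes "finite V" "v \<notin> V" "E \<subseteq> nsets (insert v V) 2"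
  shows "field_hom (insert v V) E l =
    (\<Sum>s\<in>UNIV. l v s * field_hom V {e \<in> E. v \<notin> e} (\<lambda>u. if {u, v} \<in> E then pin (l u) s else l u))"
proof -
  define U where "U = {u \<in> V. {u, v} \<in> E}"
  define E0 where "E0 = {e \<in> E. v \<notin> e}"
  have fin: "finite E" using finite_edges[of "insert v V" E] assms by simp
  have E0: "E0 \<subseteq> nsets V 2"
    using assms(3) by (auto simp: E0_def nsets_def)
  have weight: "(\<Prod>w\<in>insert v V. l w ((g(v := s)) w)) * (\<Prod>e\<in>E. edge_weight H (g(v := s)) e)
      = l v s * ((\<Prod>u\<in>V. (if {u, v} \<in> E then pin (l u) s else l u) (g u)) * (\<Prod>e\<in>E0. edge_weight H g e))" for g s
  proof -
    have "(\<Prod>w\<in>insert v V. l w ((g(v := s)) w)) = l v s * (\<Prod>u\<in>V. l u (g u))"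
      using assms(1,2) by (auto intro!: prod.cong)
    moreover have "(\<Prod>e\<in>E. edge_weight H (g(v := s)) e)
        = (\<Prod>e\<in>E0. edge_weight H (g(v := s)) e) * (\<Prod>e\<in>{e \<in> E. v \<in> e}. edge_weight H (g(v := s)) e)"
      using fin by (subst prod.union_disjoint[symmetric]) (auto simp: E0_def intro!: prod.cong)
    moreover have "(\<Prod>e\<in>E0. edge_weight H (g(v := s)) e) = (\<Prod>e\<in>E0. edge_weight H g e)"
      using E0 assms(2) by (intro prod.cong refl edge_weight_cong[OF model_H, of _ V]) auto
    moreover have "(\<Prod>e\<in>{e \<in> E. v \<in> e}. edge_weight H (g(v := s)) e) = (\<Prod>u\<in>U. h s (g u))"
      unfolding edges_at_vertex[OF assms(2,3)] U_def
      using assms(2) by (subst prod.reindex[OF inj_on_doubleton]) (auto simp: edge_weight_H intro!: prod.cong h_sym)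
    moreover have "(\<Prod>u\<in>V. (if {u, v} \<in> E then pin (l u) s else l u) (g u)) = (\<Prod>u\<in>V. l u (g u)) * (\<Prod>u\<in>U. h s (g u))"
    proof -
      have "(\<Prod>u\<in>U. h s (g u)) = (\<Prod>u\<in>V. if {u, v} \<in> E then h s (g u) else 1)"
        unfolding U_def by (rule prod.inter_filter[OF assms(1)])
      then show ?thesis
        by (simp add: prod.distrib[symmetric] pin_def if_distrib if_distribR cong: if_cong)
    qed
    ultimately show ?thesis by simp
  qed
  have "field_hom (insert v V) E l = (\<Sum>(s, g)\<in>UNIV \<times> (V \<rightarrow>\<^sub>E UNIV).
      (\<Prod>w\<in>insert v V. l w ((g(v := s)) w)) * (\<Prod>e\<in>E. edge_weight H (g(v := s)) e))"
    unfolding field_hom_def PiE_insert_eq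
    by (subst sum.reindex[OF inj_combinator[OF assms(2)]]) (simp add: case_prod_unfold)
  also have "\<dots> = (\<Sum>s\<in>UNIV. l v s * field_hom V E0 (\<lambda>u. if {u, v} \<in> E then pin (l u) s else l u))"
    by (simp only: weight field_hom_def sum_distrib_left sum.cartesian_product)
  finally show ?thesis by (simp only: E0_def)
qed

text \<open>The last vertex is adjacent to all others, so deleting it pins every field; this is the
  recursion of \<open>clique\<close>.\<close>

lemma field_hom_complete: "field_hom {..<n} (nsets {..<n} 2) (\<lambda>_. x) = clique n x"
proof (induction n arbitrary: x)
  case 0
  have "nsets {} 2 = ({} :: nat set set)" by (auto simp: nsets_def)
  then show ?case by (simp add: field_hom_def)
next
  case (Suc n)
  have ins: "{..<Suc n} = insert n {..<n}" by auto
  have E0: "{e \<in> nsets (insert n {..<n}) 2. n \<notin> e} = nsets {..<n} 2"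
    by (auto simp: nsets_def)
  have mem: "{u, n} \<in> nsets (insert n {..<n}) 2" if "u < n" for u
    using that by (auto simp: nsets_def)
  have "field_hom {..<Suc n} (nsets {..<Suc n} 2) (\<lambda>_. x)
      = (\<Sum>s\<in>UNIV. x s * field_hom {..<n} (nsets {..<n} 2)
          (\<lambda>u. if {u, n} \<in> nsets (insert n {..<n}) 2 then pin x s else x))"
    unfolding ins by (subst field_hom_delete_vertex) (auto simp: E0)
  also have "\<dots> = (\<Sum>s\<in>UNIV. x s * field_hom {..<n} (nsets {..<n} 2) (\<lambda>u. pin x s))"
    using mem by (intro sum.cong refl arg_cong2[where f = "(*)"] field_hom_cong) auto
  finally show ?case by (simp add: Suc.IH)
qed

lemma hom_complete_clique: "hom_complete n H = clique n (\<lambda>_. 1)"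
  by (simp only: hom_complete_def field_hom_one[symmetric] field_hom_complete[symmetric])

text \<open>Induction on the number of vertices, deleting a vertex \<open>v\<close> of maximum
  degree. Its neighbours lose one degree and get pinned fields, which matches the right-hand side of
  \<open>clique_vertex_step\<close>; the factors of all other vertices are unchanged.\<close>

theorem field_hom_ge:
  assumes "finite V" "E \<subseteq> nsets V 2" "\<And>v. \<forall>i. 0 < l v i"
  shows "(\<Prod>v\<in>V. clique (degree_in E v + 1) (l v) powr (1 / real (degree_in E v + 1))) \<le> field_hom V E l"
  using assms
proof (induction "card V" arbitrary: V E l)
  case 0
  then have "V = {}" "E = {}" by (auto simp: nsets_def)
  then show ?case by (simp add: field_hom_def)
next
  case (Suc n)
  \<comment> \<open>Maximality bounds the degrees of the neighbours by \<open>card U\<close>, as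
    \<open>clique_vertex_step\<close> requires.\<close>
  have "Max (degree_in E ` V) \<in> degree_in E ` V" using Suc by (intro Max_in) auto
  then obtain v where v: "v \<in> V" and "degree_in E v = Max (degree_in E ` V)" by auto
  then have max: "degree_in E u \<le> degree_in E v" if "u \<in> V" for u
    using that Suc.prems(1) by simp
  define W where "W = V - {v}"
  have W: "V = insert v W" "v \<notin> W" "finite W" "card W = n"
    using v Suc.hyps(2) Suc.prems(1) by (auto simp: W_def)
  have E: "E \<subseteq> nsets (insert v W) 2" using Suc.prems(2) W(1) by simp
  define E0 where "E0 = {e \<in> E. v \<notin> e}"
  have E0: "E0 \<subseteq> nsets W 2" using E by (auto simp: E0_def nsets_def)
  define U where "U = {u \<in> W. {u, v} \<in> E}"
  have U: "finite U" "U \<subseteq> W" using W(3) by (auto simp: U_def)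
  have cardU: "card U = degree_in E v"
    by (simp add: U_def degree_in_eq_card_neighbours[OF W(2) E])
  have degU: "degree_in E u = degree_in E0 u + 1" if "u \<in> U" for u
    using degree_in_delete_vertex[OF W(3,2) E, of u] that by (simp add: U_def E0_def)
  have degW: "degree_in E u = degree_in E0 u" if "u \<in> W - U" for u
    using degree_in_delete_vertex[OF W(3,2) E, of u] that by (simp add: U_def E0_def)
  \<comment> \<open>\<open>m s\<close> is the family of fields left after \<open>v\<close> receives
    spin \<open>s\<close>; \<open>c\<close> and \<open>q s\<close> are the factors of a vertex
    before the deletion and, for a neighbour, after it.\<close>
  define m where "m s u = (if {u, v} \<in> E then pin (l u) s else l u)" for s u
  define c where "c u = clique (degree_in E u + 1) (l u) powr (1 / real (degree_in E u + 1))" for u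
  define q where "q s u = clique (degree_in E u) (pin (l u) s) powr (1 / real (degree_in E u))" for s u
  have "(\<Prod>u\<in>V. c u) = c v * (\<Prod>u\<in>W. c u)" using W by simp
  also have "(\<Prod>u\<in>W. c u) = (\<Prod>u\<in>W - U. c u) * (\<Prod>u\<in>U. c u)"
    using prod.subset_diff[OF U(2) W(3)] .
  also have "c v * ((\<Prod>u\<in>W - U. c u) * (\<Prod>u\<in>U. c u)) = (\<Prod>u\<in>W - U. c u) * (c v * (\<Prod>u\<in>U. c u))"
    by simp
  also have "\<dots> \<le> (\<Prod>u\<in>W - U. c u) * (\<Sum>s\<in>UNIV. l v s * (\<Prod>u\<in>U. q s u))"
  proof (rule mult_left_mono)
    have "1 \<le> degree_in E u \<and> degree_in E u \<le> card U" if "u \<in> U" for u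
      using degU[OF that] max[of u] that U(2) W(1) cardU by auto
    then show "c v * (\<Prod>u\<in>U. c u) \<le> (\<Sum>s\<in>UNIV. l v s * (\<Prod>u\<in>U. q s u))"
      using clique_vertex_step[where U = U and k = "degree_in E" and x = "l v" and z = l] U(1) Suc.prems(3)
      unfolding c_def q_def cardU by blast
    show "0 \<le> (\<Prod>u\<in>W - U. c u)" by (simp add: c_def prod_nonneg)
  qed
  also have "\<dots> = (\<Sum>s\<in>UNIV. l v s * ((\<Prod>u\<in>W - U. c u) * (\<Prod>u\<in>U. q s u)))"
    by (simp add: sum_distrib_left mult_ac)
  also have "\<dots> \<le> (\<Sum>s\<in>UNIV. l v s * field_hom W E0 (m s))"
  proof (intro sum_mono mult_left_mono)
    fix s
    have "(\<Prod>u\<in>W. clique (degree_in E0 u + 1) (m s u) powr (1 / real (degree_in E0 u + 1))) \<le> field_hom W E0 (m s)"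
      using W(4) Suc.prems(3) by (intro Suc.hyps(1) W(3) E0) (auto simp: m_def pin_pos)
    also have "(\<Prod>u\<in>W. clique (degree_in E0 u + 1) (m s u) powr (1 / real (degree_in E0 u + 1)))
        = (\<Prod>u\<in>W - U. c u) * (\<Prod>u\<in>U. q s u)"
      unfolding prod.subset_diff[OF U(2) W(3)]
    proof (intro arg_cong2[where f = "(*)"] prod.cong refl)
      fix u assume u: "u \<in> W - U"
      then have "m s u = l u" by (auto simp: m_def U_def)
      then show "clique (degree_in E0 u + 1) (m s u) powr (1 / real (degree_in E0 u + 1)) = c u"
        using degW[OF u] by (simp only: c_def)
    next
      fix u assume u: "u \<in> U"
      then have "m s u = pin (l u) s" by (auto simp: m_def U_def)
      then show "clique (degree_in E0 u + 1) (m s u) powr (1 / real (degree_in E0 u + 1)) = q s u"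
        using degU[OF u] by (simp only: q_def)
    qed
    finally show "(\<Prod>u\<in>W - U. c u) * (\<Prod>u\<in>U. q s u) \<le> field_hom W E0 (m s)" .
  qed (use Suc.prems(3) in \<open>auto simp: less_imp_le\<close>)
  also have "\<dots> = field_hom V E l"
    unfolding W(1) field_hom_delete_vertex[OF W(3,2) E] m_def E0_def ..
  finally show ?case by (simp only: c_def)
qed

lemma hom_ge:
  assumes "finite V" "E \<subseteq> nsets V 2"
  shows "(\<Prod>v\<in>V. hom_complete (degree_in E v + 1) H powr (1 / real (degree_in E v + 1))) \<le> hom V E H"
  using field_hom_ge[OF assms, of "\<lambda>_ _. 1"]
  by (simp add: field_hom_one hom_complete_clique del: clique.simps)

end

section \<open>Approximation by positive models\<close>

lemma antiferromagnetic_bform: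
  fixes H :: "real ^ 'i ^ 'i"
  assumes "antiferromagnetic H" "\<forall>i. 0 \<le> f i"
  shows "bform (\<lambda>s t. H $ s $ t) f f * bform (\<lambda>s t. H $ s $ t) g g \<le> (bform (\<lambda>s t. H $ s $ t) f g)\<^sup>2"
proof -
  have "(\<chi> i. a i) \<bullet> (H *v (\<chi> i. b i)) = bform (\<lambda>s t. H $ s $ t) a b" for a b
    by (simp add: bform_def inner_vec_def matrix_vector_mult_def sum_distrib_left mult_ac)
  then show ?thesis
    using antiferromagnetic_reverse_Cauchy_Schwarz[OF assms(1), of "\<chi> i. f i" "\<chi> i. g i"] assms(2) by simp
qed

text \<open>The perturbation is the congruence of \<open>H\<close> by \<open>1 + \<delta> J\<close> with \<open>J\<close> the all-ones matrix; if
  \<open>H = 0\<close>, it is \<open>\<delta> J\<close>.\<close>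
lemma positive_perturbation:
  fixes H :: "real ^ 'i ^ 'i"
  assumes af: "antiferromagnetic H"
  obtains h :: "real \<Rightarrow> 'i \<Rightarrow> 'i \<Rightarrow> real" where
    "\<And>\<delta>. 0 < \<delta> \<Longrightarrow> positive_model (h \<delta>)" "\<And>s t. ((\<lambda>\<delta>. h \<delta> s t) \<longlongrightarrow> H $ s $ t) (at_right 0)"
proof (cases "H = 0")
  case True
  define h where "h \<delta> s t = \<delta>" for \<delta> :: real and s t :: 'i
  have "positive_model (h \<delta>)" if "0 < \<delta>" for \<delta>
  proof
    fix f g :: "'i \<Rightarrow> real"
    have "bform (h \<delta>) f g = \<delta> * (sum f UNIV * sum g UNIV)" for f g
      unfolding bform_def h_def sum_product unfolding sum_distrib_left by (simp only: mult.assoc)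
    then show "bform (h \<delta>) f f * bform (h \<delta>) g g \<le> (bform (h \<delta>) f g)\<^sup>2"
      by (simp add: power2_eq_square mult_ac)
  qed (use that in \<open>auto simp: h_def\<close>)
  moreover have "((\<lambda>\<delta>. h \<delta> s t) \<longlongrightarrow> H $ s $ t) (at_right 0)" for s t
    by (simp add: True h_def tendsto_ident_at)
  ultimately show thesis by (rule that)
next
  case False
  have Hsym: "H $ s $ t = H $ t $ s" and nn: "0 \<le> H $ s $ t" for s t
    using af by (auto simp: antiferromagnetic_def model_def transpose_def vec_eq_iff)
  define M where "M s t = H $ s $ t" for s t
  define R where "R s = (\<Sum>t\<in>UNIV. M s t)" for s
  define T where "T = (\<Sum>s\<in>UNIV. R s)"
  have Msym: "M s t = M t s" for s t using Hsym by (simp add: M_def)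
  have R: "0 \<le> R s" for s by (simp add: R_def M_def nn sum_nonneg)
  have T: "0 < T"
  proof -
    obtain s t where "H $ s $ t \<noteq> 0" using False by (auto simp: vec_eq_iff)
    then have "0 < M s t" using nn[of s t] by (simp add: M_def)
    also have "M s t \<le> R s" unfolding R_def by (rule member_le_sum) (auto simp: M_def nn)
    also have "R s \<le> T" unfolding T_def by (rule member_le_sum) (auto simp: R)
    finally show ?thesis .
  qed
  \<comment> \<open>\<open>R\<close> and \<open>T\<close> are the row sums and the total sum of
    \<open>M\<close>, so these are the entries of the congruent matrix; \<open>T > 0\<close> makes
    all of them positive.\<close>
  define h where "h \<delta> s t = M s t + \<delta> * R s + \<delta> * R t + \<delta>\<^sup>2 * T" for \<delta> s t
  \<comment> \<open>The congruence acts on test functions by adding \<delta> times their sum, which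
    preserves nonnegativity; hence the reverse Cauchy-Schwarz inequality is inherited.\<close>
  have bform_h: "bform (h \<delta>) f g = bform M (\<lambda>s. f s + \<delta> * sum f UNIV) (\<lambda>s. g s + \<delta> * sum g UNIV)" for \<delta> f g
  proof -
    define F where "F = sum f UNIV"
    define G where "G = sum g UNIV"
    let ?o = "\<lambda>_::'i. 1::real"
    have one: "bform M ?o k = (\<Sum>s\<in>UNIV. R s * k s)" for k
      by (simp add: bform_one_left[OF Msym] R_def)
    have scale: "bform M a (\<lambda>s. b s + c) = bform M a b + c * bform M ?o a" for a b c
      using bform_add_scale_right[of M a b c ?o] bform_commute[OF Msym, where f = a and g = ?o] by simp
    have "bform M (\<lambda>s. f s + \<delta> * F) (\<lambda>s. g s + \<delta> * G)
        = bform M (\<lambda>s. f s + \<delta> * F) g + \<delta> * G * bform M ?o (\<lambda>s. f s + \<delta> * F)"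
      by (rule scale)
    also have "bform M (\<lambda>s. f s + \<delta> * F) g = bform M f g + \<delta> * F * bform M ?o g"
      using scale[of g f "\<delta> * F"] by (simp add: bform_commute[OF Msym, where g = g])
    also have "bform M ?o (\<lambda>s. f s + \<delta> * F) = bform M ?o f + \<delta> * F * T"
      using scale[of ?o f "\<delta> * F"] one[of ?o] by (simp add: T_def)
    also have "bform M f g + \<delta> * F * bform M ?o g + \<delta> * G * (bform M ?o f + \<delta> * F * T)
       = bform M f g + \<delta> * ((\<Sum>s\<in>UNIV. R s * f s) * G) + \<delta> * (F * (\<Sum>t\<in>UNIV. R t * g t)) + \<delta>\<^sup>2 * T * (F * G)"
      by (simp add: one algebra_simps power2_eq_square)
    also have "\<dots> = bform (h \<delta>) f g"
    proof -
      have "bform (h \<delta>) f g = bform M f g + \<delta> * (\<Sum>s\<in>UNIV. \<Sum>t\<in>UNIV. R s * f s * g t)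
          + \<delta> * (\<Sum>s\<in>UNIV. \<Sum>t\<in>UNIV. f s * (R t * g t)) + \<delta>\<^sup>2 * T * (\<Sum>s\<in>UNIV. \<Sum>t\<in>UNIV. f s * g t)"
        by (simp add: bform_def h_def sum_distrib_left distrib_left distrib_right sum.distrib mult_ac)
      then show ?thesis by (simp only: F_def G_def sum_product)
    qed
    finally show ?thesis by (simp add: F_def G_def)
  qed
  have "positive_model (h \<delta>)" if \<delta>: "0 < \<delta>" for \<delta>
  proof
    fix s t
    show "h \<delta> s t = h \<delta> t s" by (simp add: h_def Msym[of s t])
    show "0 < h \<delta> s t" using \<delta> T R nn unfolding h_def M_def
      by (intro add_nonneg_pos add_nonneg_nonneg mult_nonneg_nonneg mult_pos_pos) auto
  next
    fix f g :: "'i \<Rightarrow> real"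
    assume "\<forall>i. 0 < f i"
    then have "\<forall>i. 0 \<le> f i + \<delta> * sum f UNIV"
      using \<delta> by (intro allI add_nonneg_nonneg mult_nonneg_nonneg sum_nonneg) (auto simp: less_imp_le)
    from antiferromagnetic_bform[OF af this, of "\<lambda>s. g s + \<delta> * sum g UNIV"]
    show "bform (h \<delta>) f f * bform (h \<delta>) g g \<le> (bform (h \<delta>) f g)\<^sup>2"
      unfolding bform_h M_def[abs_def] .
  qed
  moreover have "((\<lambda>\<delta>. h \<delta> s t) \<longlongrightarrow> H $ s $ t) (at_right 0)" for s t
  proof -
    have "((\<lambda>\<delta>. h \<delta> s t) \<longlongrightarrow> M s t + 0 * R s + 0 * R t + 0\<^sup>2 * T) (at_right 0)"
      unfolding h_def by (intro tendsto_intros)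
    then show ?thesis by (simp add: M_def)
  qed
  ultimately show thesis by (rule that)
qed

text \<open>A finite sum of finite products is continuous in the matrix entries. Symmetry near the
  limit is assumed because \<open>edge_weight\<close> is a definite description that is evaluated
  through \<open>model\<close>.\<close>

lemma tendsto_hom:
  fixes H :: "real ^ 'i ^ 'i" and G :: "'a \<Rightarrow> real ^ 'i ^ 'i"
  assumes "model H" "\<And>s t. ((\<lambda>x. G x $ s $ t) \<longlongrightarrow> H $ s $ t) F" "eventually (\<lambda>x. model (G x)) F"
    and E: "E \<subseteq> nsets V 2"
  shows "((\<lambda>x. hom V E (G x)) \<longlongrightarrow> hom V E H) F"
  unfolding hom_def
proof (intro tendsto_sum tendsto_prod)
  fix \<phi> e assume "e \<in> E"
  then obtain u v where e: "e = {u, v}" using E by (meson nsets_2_cases subsetD)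
  have "((\<lambda>x. G x $ \<phi> u $ \<phi> v) \<longlongrightarrow> edge_weight H \<phi> e) F"
    using assms(2) by (simp add: e edge_weight_doubleton[OF assms(1)])
  moreover have "eventually (\<lambda>x. G x $ \<phi> u $ \<phi> v = edge_weight (G x) \<phi> e) F"
    using assms(3) by eventually_elim (simp add: e edge_weight_doubleton)
  ultimately show "((\<lambda>x. edge_weight (G x) \<phi> e) \<longlongrightarrow> edge_weight H \<phi> e) F"
    by (rule Lim_transform_eventually)
qed

lemma hom_nonneg:
  assumes "model H" "E \<subseteq> nsets V 2"
  shows "0 \<le> hom V E H"
  unfolding hom_def
proof (intro sum_nonneg prod_nonneg)
  fix \<phi> e assume "e \<in> E"
  then obtain u v where e: "e = {u, v}" using assms(2) by (meson nsets_2_cases subsetD)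
  show "0 \<le> edge_weight H \<phi> e"
    using assms(1) unfolding e edge_weight_doubleton[OF assms(1)] by (simp add: model_def)
qed

theorem theorem1p1:
  fixes H :: "real ^ 'i ^ 'i" and V :: "'v set" and E :: "'v set set"
  assumes "model H" and "antiferromagnetic H"
    and "finite_simple_graph V E"
  shows "hom V E H \<ge>
    (\<Prod>v\<in>V. hom_complete (degree_in E v + 1) H powr (1 / real (degree_in E v + 1)))"
proof -
  have V: "finite V" "E \<subseteq> nsets V 2" using assms(3) by (auto simp: finite_simple_graph_def)
  obtain h :: "real \<Rightarrow> 'i \<Rightarrow> 'i \<Rightarrow> real" where
    pm: "\<And>\<delta>. 0 < \<delta> \<Longrightarrow> positive_model (h \<delta>)" and lim: "\<And>s t. ((\<lambda>\<delta>. h \<delta> s t) \<longlongrightarrow> H $ s $ t) (at_right 0)"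
    using positive_perturbation[OF assms(2)] by blast
  define G where "G \<delta> = positive_model.H (h \<delta>)" for \<delta>
  have ev: "eventually (\<lambda>\<delta>. (0::real) < \<delta>) (at_right 0)" by (simp add: eventually_at_right_less)
  have limG: "((\<lambda>\<delta>. G \<delta> $ s $ t) \<longlongrightarrow> H $ s $ t) (at_right 0)" for s t
  proof (rule Lim_transform_eventually[OF lim])
    show "eventually (\<lambda>\<delta>. h \<delta> s t = G \<delta> $ s $ t) (at_right 0)"
      using ev by eventually_elim (simp add: G_def positive_model.H_def[OF pm])
  qed
  have modelG: "eventually (\<lambda>\<delta>. model (G \<delta>)) (at_right 0)"
    using ev by eventually_elim (simp add: G_def positive_model.model_H[OF pm])
  have lim_complete: "((\<lambda>\<delta>. hom_complete m (G \<delta>)) \<longlongrightarrow> hom_complete m H) (at_right 0)" for m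
    unfolding hom_complete_def by (rule tendsto_hom[OF assms(1) limG modelG order_refl])
  have "((\<lambda>\<delta>. \<Prod>v\<in>V. hom_complete (degree_in E v + 1) (G \<delta>) powr (1 / real (degree_in E v + 1)))
      \<longlongrightarrow> (\<Prod>v\<in>V. hom_complete (degree_in E v + 1) H powr (1 / real (degree_in E v + 1)))) (at_right 0)"
  \<comment> \<open>A limit \<open>hom_complete m H\<close> may be zero; continuity of
    \<open>powr\<close> there rests on nonnegative bases and a positive exponent.\<close>
  proof (intro tendsto_prod tendsto_powr' lim_complete tendsto_const disjI2 conjI)
    show "eventually (\<lambda>\<delta>. 0 \<le> hom_complete (degree_in E v + 1) (G \<delta>)) (at_right 0)" for v
      using modelG by eventually_elim (simp add: hom_complete_def hom_nonneg)
  qed simp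
  moreover have "((\<lambda>\<delta>. hom V E (G \<delta>)) \<longlongrightarrow> hom V E H) (at_right 0)"
    by (rule tendsto_hom[OF assms(1) limG modelG V(2)])
  moreover have "eventually (\<lambda>\<delta>. (\<Prod>v\<in>V. hom_complete (degree_in E v + 1) (G \<delta>) powr (1 / real (degree_in E v + 1)))
      \<le> hom V E (G \<delta>)) (at_right 0)"
    using ev by eventually_elim (simp only: G_def positive_model.hom_ge[OF pm V])
  ultimately show ?thesis
    by (intro tendsto_le[OF trivial_limit_at_right_real])
qed

end
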